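(* Let $\pi_{\mathsf{FA}}$ be the fair allocation policy with uniformly-at-random tie-breaking. Let $0<\underline q<\bar q<1$ and $\underline\alpha>0$, and let $(n,C(n),q^{(n)})$ be a sequence of instances such that (1) $q^{(n)}=(q_1^{(n)},\dots,q_n^{(n)})\in[\underline q,\bar q]^n$, and (2) $C(n)\ge\underline\alpha n$ for all sufficiently large $n$. Then there exists a constant $K=K(\underline\alpha,\underline q,\bar q)<\infty$ such that, for all sufficiently large $n$, $$0\le\mathbb E\big[T^{\pi_{\mathsf{FA}}}(q^{(n)};C(n))\big]-\mathbb E\big[T^*(q^{(n)};C(n))\big]\le K.$$
   Context: Model. An instance $(n,C,q)$ has $n\ge1$ threats $[n]=\{1,\dots,n\}$, a per-round capacity $C\in\mathbb Z_{\ge1}$ of effectors, and difficulties $q=(q_i)\in[0,1)^n$, where $q_i$ is the probability that a single effector fails to neutralize threat $i$. Demands $L_1,\dots,L_n$ are independent, $L_i\sim\mathrm{Geom}(1-q_i)$ on $\{1,2,\dots\}$, i.e. $\Pr(L_i>k)=q_i^k$. $\mathcal M_t\subseteq[n]$ is the set of active threats at the start of round $t$, $\mathcal M_1=[n]$. A (deterministic) policy is $\pi=(\pi_t)_{t\ge1}$, where $\pi_t$ maps each subset $\mathcal M\subseteq[n]$ to a vector $\pi_t(\mathcal M)\in\mathbb Z_{\ge0}^n$ with $\sum_{i\in[n]}[\pi_t(\mathcal M)]_i\le C$ and, for every nonempty $\mathcal M$ and every $t$, $\sum_{i\in\mathcal M}[\pi_t(\mathcal M)]_i=C$; $\Pi$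 is the set of all such policies. Under $\pi$, the round-$t$ allocation is $x^t=\pi_t(\mathcal M_t)$ (for a randomized policy, $x^t$ is drawn at random from a distribution $\pi_t(\mathcal M_t)$ over such allocations, independently of the demands given $\mathcal M_t$) and $\mathcal M_{t+1}=\{i\in\mathcal M_t:\sum_{\ell=1}^t x_i^\ell<L_i\}$. The defusing time is $T^\pi(q;C)=\min\{t:\sum_{\ell=1}^t x_i^\ell\ge L_i\ \forall i\in[n]\}$, and $\mathbb E[T^*(q;C)]=\min_{\pi\in\Pi}\mathbb E[T^\pi(q;C)]$. Fair allocation. For nonempty $\mathcal M\subseteq[n]$, $x\in\mathbb Z_{\ge0}^n$ is fair for $\mathcal M$ if $\sum_{i\in\mathcal M}x_i=C$, $x_i=0$ for $i\notin\mathcal M$, and $|x_i-x_j|\in\{0,1\}$ for all $i,j\in\mathcal M$. The fair allocation policy with uniformly-at-random tie-breaking selects, in each round $t$ with $\mathcal M_t\neq\emptyset$, one of the fair allocations for $\mathcal M_t$ uniformly at random. *)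

theory Defs
  imports "HOL-Probability.Probability"
begin

definition threat_instance :: "nat \<Rightarrow> nat \<Rightarrow> (nat \<Rightarrow> real) \<Rightarrow> bool" where
  "threat_instance n C q \<longleftrightarrow> n \<ge> 1 \<and> C \<ge> 1 \<and> (\<forall>i\<in>{1..n}. 0 \<le> q i \<and> q i < 1)"

text \<open>The library's \<^term>\<open>geometric_pmf p\<close> counts failures and lives on \<open>{0,1,...}\<close>, hence the
  shift by \<^const>\<open>Suc\<close>: \<open>Pr (L i > k) = q i ^ k\<close>.\<close>

definition demands :: "nat \<Rightarrow> (nat \<Rightarrow> real) \<Rightarrow> (nat \<Rightarrow> nat) pmf" where
  "demands n q = Pi_pmf {1..n} 0 (\<lambda>i. map_pmf Suc (geometric_pmf (1 - q i)))"

text \<open>An allocation is a function \<open>x\<close> of which only the coordinates in \<open>{1..n}\<close> are ever used.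
  The term \<open>p t M\<close> is the allocation of the deterministic policy \<open>p\<close> in round \<open>t \<ge> 1\<close>
  when \<open>M\<close> is the set of active threats.\<close>

type_synonym policy = "nat \<Rightarrow> nat set \<Rightarrow> nat \<Rightarrow> nat"

definition policies :: "nat \<Rightarrow> nat \<Rightarrow> policy set" where
  "policies n C = {p. \<forall>t\<ge>1. \<forall>M\<subseteq>{1..n}.
     (\<Sum>i\<in>{1..n}. p t M i) \<le> C \<and> (M \<noteq> {} \<longrightarrow> (\<Sum>i\<in>M. p t M i) = C)}"

text \<open>Rounds are numbered from 1; the value at \<open>0\<close> is irrelevant.\<close>

fun active :: "nat \<Rightarrow> policy \<Rightarrow> (nat \<Rightarrow> nat) \<Rightarrow> nat \<Rightarrow> nat set" where
  "active n p L 0 = {1..n}"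
| "active n p L (Suc 0) = {1..n}"
| "active n p L (Suc (Suc t)) =
     {i \<in> active n p L (Suc t). (\<Sum>l = 1..Suc t. p l (active n p L l) i) < L i}"

text \<open>The infimum of the empty set is \<open>\<infinity>\<close>, so \<open>defusing_time n p L = \<infinity>\<close> if some threat is never
  neutralized.\<close>

definition defusing_time :: "nat \<Rightarrow> policy \<Rightarrow> (nat \<Rightarrow> nat) \<Rightarrow> ennreal" where
  "defusing_time n p L =
     (INF t\<in>{t. t \<ge> 1 \<and> (\<forall>i\<in>{1..n}. L i \<le> (\<Sum>l = 1..t. p l (active n p L l) i))}. of_nat t)"

definition expected_time :: "nat \<Rightarrow> (nat \<Rightarrow> real) \<Rightarrow> policy \<Rightarrow> ennreal" where
  "expected_time n q p = (\<integral>\<^sup>+ L. defusing_time n p L \<partial>measure_pmf (demands n q))"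

text \<open>The minimum over all policies. It is attained: there are finitely many relevant choices
  for each pair of a round and an active set, and \<open>expected_time n q\<close> is lower
  semicontinuous in the policy.\<close>

definition optimal_expected_time :: "nat \<Rightarrow> nat \<Rightarrow> (nat \<Rightarrow> real) \<Rightarrow> ennreal" where
  "optimal_expected_time n C q = (INF p\<in>policies n C. expected_time n q p)"

text \<open>A randomized policy \<open>r\<close> gives a distribution \<open>r t M\<close> over allocations. Its randomness is
  realized by drawing, independently of the demands and of each other, one allocation \<open>p t M\<close>
  from \<open>r t M\<close> for every round \<open>t\<close> and every \<open>M \<subseteq> {1..n}\<close>, and by then playing
  \<open>p t (active n p L t)\<close>. The set \<open>active n p L t\<close> only depends on the demands and the
  draws for earlier rounds, so given the history the round-\<open>t\<close> allocation has distribution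
  \<open>r t (active n p L t)\<close>.\<close>

type_synonym randomized_policy = "nat \<Rightarrow> nat set \<Rightarrow> (nat \<Rightarrow> nat) pmf"

definition policy_draws :: "nat \<Rightarrow> randomized_policy \<Rightarrow> policy measure" where
  "policy_draws n r = PiM UNIV (\<lambda>t. measure_pmf (Pi_pmf (Pow {1..n}) (\<lambda>_. 0) (r t)))"

definition expected_time_randomized :: "nat \<Rightarrow> (nat \<Rightarrow> real) \<Rightarrow> randomized_policy \<Rightarrow> ennreal" where
  "expected_time_randomized n q r =
     (\<integral>\<^sup>+ (L, p). defusing_time n p L \<partial>(measure_pmf (demands n q) \<Otimes>\<^sub>M policy_draws n r))"

definition fair :: "nat \<Rightarrow> nat set \<Rightarrow> (nat \<Rightarrow> nat) \<Rightarrow> bool" where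
  "fair C M x \<longleftrightarrow> (\<Sum>i\<in>M. x i) = C \<and> (\<forall>i. i \<notin> M \<longrightarrow> x i = 0) \<and>
     (\<forall>i\<in>M. \<forall>j\<in>M. \<bar>int (x i) - int (x j)\<bar> \<in> {0, 1})"

definition fair_allocation_policy :: "nat \<Rightarrow> randomized_policy" where
  "fair_allocation_policy C t M =
     (if M = {} then return_pmf (\<lambda>_. 0) else pmf_of_set {x. fair C M x})"

end

theory Submission
  imports Defs
begin

text \<open>By memorylessness of the geometric distribution the active sets form a Markov chain: from \<open>M\<close>, an
  allocation \<open>x\<close> keeps each \<open>i \<in> M\<close> independently with probability \<open>q i ^ x i\<close>. The expected time is
  the sum over the rounds of the probabilities that the chain has not yet reached \<open>{}\<close>.

  Measure progress by the number \<open>r = C / card M\<close> of effectors per active threat. A fair allocation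
  keeps on average at most a fraction \<open>\<epsilon>(r)\<^sup>2\<close> of the threats, where \<open>\<epsilon>(r)\<close> is bounded away from \<open>1\<close>
  and decays exponentially in \<open>r\<close>. By Markov's inequality the ratio climbs from \<open>R\<^sub>j\<close> to
  \<open>R\<^sub>j\<^sub>+\<^sub>1 = R\<^sub>j / \<epsilon>(R\<^sub>j)\<close> in one round except with probability \<open>\<epsilon>(R\<^sub>j)\<close>, and these
  probabilities are summable, so the expected time exceeds the number of levels up to \<open>C\<close> by at most
  a constant. Conversely, by convexity every policy keeps on average at least a fraction \<open>ql powr r\<close>
  of the threats, and a Chernoff bound shows that with probability at least \<open>1 - S\<^sub>j\<^sub>+\<^sub>1 / C\<close> the ratio
  does not jump beyond \<open>S\<^sub>j\<^sub>+\<^sub>1 = 4 S\<^sub>j ql powr (- S\<^sub>j)\<close> in one round. Both sequences start at \<open>C / n\<close>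
  and grow like iterated exponentials, and \<open>R\<close> overtakes \<open>S\<close> after a bounded shift of the index.\<close>

section \<open>Residual demands and the Markov chain of active sets\<close>

abbreviation geom1 :: "real \<Rightarrow> nat pmf" where
  "geom1 q \<equiv> map_pmf Suc (geometric_pmf (1 - q))"

definition survivors :: "(nat \<Rightarrow> real) \<Rightarrow> nat set \<Rightarrow> (nat \<Rightarrow> nat) \<Rightarrow> nat set pmf" where
  "survivors q M x = map_pmf (\<lambda>b. {i\<in>M. b i}) (Pi_pmf M False (\<lambda>i. bernoulli_pmf (q i ^ x i)))"

text \<open>The index counts completed rounds: time \<open>t\<close> of the chain is the start of
  round \<open>Suc t\<close>, that is, \<open>active n p L (Suc t)\<close>. Hence the transition
  uses \<open>p (Suc t)\<close>.\<close>

fun active_law :: "nat \<Rightarrow> (nat \<Rightarrow> real) \<Rightarrow> policy \<Rightarrow> nat \<Rightarrow> nat set pmf" where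
  "active_law n q p 0 = return_pmf {1..n}"
| "active_law n q p (Suc t) =
     bind_pmf (active_law n q p t) (\<lambda>M. survivors q M (p (Suc t) M))"

lemma bernoulli_pmf_1: "bernoulli_pmf 1 = return_pmf True"
  by (rule pmf_eqI) (case_tac i; simp)

text \<open>A single effector performs the first trial of the geometric variable: it either ends the
  threat or leaves a fresh copy of the demand.\<close>

lemma geom1_minus_1:
  assumes "0 \<le> q" "q < 1"
  shows "map_pmf (\<lambda>k. k - 1) (geom1 q) =
    bind_pmf (bernoulli_pmf q) (\<lambda>b. if b then geom1 q else return_pmf 0)"
proof -
  have "map_pmf (\<lambda>k. k - 1) (geom1 q) = geometric_pmf (1 - q)"
    by (simp add: pmf.map_comp o_def pmf.map_ident)
  also have "\<dots> = bind_pmf (bernoulli_pmf (1 - q)) (\<lambda>b. if b then return_pmf 0 else geom1 q)"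
    using assms by (intro geometric_bind_pmf_unfold) auto
  \<comment> \<open>The coin is flipped so that \<open>True\<close> means survival rather than
    neutralization.\<close>
  also have "bernoulli_pmf (1 - q) = map_pmf Not (bernoulli_pmf q)"
    using assms pmf_map_inj'[of Not "bernoulli_pmf q" False] pmf_map_inj'[of Not "bernoulli_pmf q" True]
    by (intro pmf_eqI, case_tac i) (auto simp: inj_on_def)
  finally show ?thesis by (auto simp: bind_map_pmf intro!: bind_pmf_cong)
qed

text \<open>The effectors act one at a time; the value \<open>0\<close> absorbs because subtraction
  truncates.\<close>

lemma geom1_minus:
  assumes q: "0 \<le> q" "q < 1"
  shows "map_pmf (\<lambda>k. k - x) (geom1 q) =
    bind_pmf (bernoulli_pmf (q ^ x)) (\<lambda>b. if b then geom1 q else return_pmf 0)"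
proof (induction x)
  case 0
  show ?case by (simp add: bernoulli_pmf_1 bind_return_pmf pmf.map_ident)
next
  case (Suc x)
  have qx: "0 \<le> q ^ x" "q ^ x \<le> 1" using q by (auto intro: power_le_one)
  have "map_pmf (\<lambda>k. k - Suc x) (geom1 q) = map_pmf (\<lambda>k. k - 1) (map_pmf (\<lambda>k. k - x) (geom1 q))"
    by (simp add: pmf.map_comp o_def)
  also have "\<dots> = bind_pmf (bernoulli_pmf (q ^ x)) (\<lambda>b. if b then map_pmf (\<lambda>k. k - 1) (geom1 q) else return_pmf 0)"
    unfolding Suc.IH by (simp add: map_bind_pmf if_distrib cong: if_cong)
  also have "\<dots> = bind_pmf (bind_pmf (bernoulli_pmf (q ^ x)) (\<lambda>b. if b then bernoulli_pmf q else return_pmf False))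
       (\<lambda>b. if b then geom1 q else return_pmf 0)"
    unfolding geom1_minus_1[OF q]
    by (simp add: bind_assoc_pmf if_distrib bind_return_pmf if_distribR cong: if_cong)
  also have "bind_pmf (bernoulli_pmf (q ^ x)) (\<lambda>b. if b then bernoulli_pmf q else return_pmf False)
     = bernoulli_pmf (q ^ Suc x)"
    using qx q mult_le_one[of q "q^x"] by (intro pmf_eqI, case_tac i)
      (auto simp: pmf_bind algebra_simps)
  finally show ?case .
qed

text \<open>Memorylessness holds in every coordinate, and independence lifts it to the product. The
  point masses in the proof bring the subtraction into the form required by
  \<open>Pi_pmf_bind\<close>.\<close>

lemma demands_memoryless:
  assumes M: "finite M" and q: "\<And>i. i \<in> M \<Longrightarrow> 0 \<le> q i \<and> q i < 1"
  shows "map_pmf (\<lambda>R i. R i - x i) (Pi_pmf M 0 (\<lambda>i. geom1 (q i))) =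
    bind_pmf (survivors q M x) (\<lambda>M'. Pi_pmf M' 0 (\<lambda>i. geom1 (q i)))"
proof -
  have "map_pmf (\<lambda>R i. R i - x i) (Pi_pmf M 0 (\<lambda>i. geom1 (q i))) =
     bind_pmf (Pi_pmf M 0 (\<lambda>i. geom1 (q i))) (\<lambda>R. Pi_pmf M 0 (\<lambda>i. return_pmf (R i - x i)))"
    unfolding map_pmf_def[of "\<lambda>R i. R i - x i"] using set_Pi_pmf_subset[OF M, of 0 "\<lambda>i. geom1 (q i)"] M
    by (intro bind_pmf_cong refl) (auto simp: fun_eq_iff)
  also have "\<dots> = Pi_pmf M 0 (\<lambda>i. map_pmf (\<lambda>k. k - x i) (geom1 (q i)))"
    unfolding map_pmf_def[of "\<lambda>k. k - _"] by (rule Pi_pmf_bind[OF M, symmetric])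
  also have "\<dots> = Pi_pmf M 0 (\<lambda>i. bind_pmf (bernoulli_pmf (q i ^ x i)) (\<lambda>b. if b then geom1 (q i) else return_pmf 0))"
    using q by (intro Pi_pmf_cong refl) (simp only: geom1_minus)
  also have "\<dots> = bind_pmf (Pi_pmf M False (\<lambda>i. bernoulli_pmf (q i ^ x i)))
      (\<lambda>b. Pi_pmf M 0 (\<lambda>i. if b i then geom1 (q i) else return_pmf 0))"
    by (rule Pi_pmf_bind[OF M])
  \<comment> \<open>A neutralized coordinate is a point mass at the default value \<open>0\<close>,
    so it drops out of the product.\<close>
  also have "\<dots> = bind_pmf (survivors q M x) (\<lambda>M'. Pi_pmf M' 0 (\<lambda>i. geom1 (q i)))"
    unfolding survivors_def bind_map_pmf Pi_pmf_if_set[OF M] ..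
  finally show ?thesis .
qed

text \<open>Subtraction on \<^typ>\<open>nat\<close> truncates, so a neutralized threat keeps residual demand \<open>0\<close> and the
  active set is the support of the residual demand.\<close>

fun residual :: "policy \<Rightarrow> (nat \<Rightarrow> nat) \<Rightarrow> nat \<Rightarrow> nat \<Rightarrow> nat" where
  "residual p L 0 = L"
| "residual p L (Suc t) = (\<lambda>i. residual p L t i - p (Suc t) {i. 0 < residual p L t i} i)"

lemma set_survivors: "finite M \<Longrightarrow> M' \<in> set_pmf (survivors q M x) \<Longrightarrow> M' \<subseteq> M"
  by (auto simp: survivors_def)

lemma set_active_law: "M \<in> set_pmf (active_law n q p t) \<Longrightarrow> M \<subseteq> {1..n}"
proof (induction t arbitrary: M)
  case (Suc t)
  then obtain M0 where "M0 \<in> set_pmf (active_law n q p t)" "M \<in> set_pmf (survivors q M0 (p (Suc t) M0))"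
    by auto
  with Suc.IH[of M0] set_survivors[of M0 M] show ?case
    by (meson finite_atLeastAtMost finite_subset subset_trans)
qed auto

lemma support_Pi_geom1:
  assumes "finite M" "R \<in> set_pmf (Pi_pmf M 0 (\<lambda>i. geom1 (q i)))"
  shows "{i. 0 < R i} = M"
proof -
  have "R i \<in> range Suc" if "i \<in> M" for i
    using assms that by (auto simp: set_Pi_pmf PiE_dflt_def)
  moreover have "R i = 0" if "i \<notin> M" for i
    using assms that by (auto simp: set_Pi_pmf PiE_dflt_def)
  ultimately show ?thesis by fastforce
qed

text \<open>The policy sees only the active set, so by memorylessness the residual demands given
  that set are again fresh independent geometric variables; this invariant is what makes the active
  sets a Markov chain.\<close>

lemma residual_law:
  assumes q: "\<And>i. i \<in> {1..n} \<Longrightarrow> 0 \<le> q i \<and> q i < 1"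
  shows "map_pmf (\<lambda>L. residual p L t) (demands n q) =
    bind_pmf (active_law n q p t) (\<lambda>M. Pi_pmf M 0 (\<lambda>i. geom1 (q i)))"
proof (induction t)
  case 0
  show ?case by (simp add: demands_def bind_return_pmf pmf.map_ident)
next
  case (Suc t)
  let ?step = "\<lambda>R i. R i - p (Suc t) {i. 0 < R i} i"
  have "map_pmf (\<lambda>L. residual p L (Suc t)) (demands n q) =
      map_pmf ?step (map_pmf (\<lambda>L. residual p L t) (demands n q))"
    by (simp add: pmf.map_comp o_def)
  also have "\<dots> = bind_pmf (active_law n q p t) (\<lambda>M. map_pmf ?step (Pi_pmf M 0 (\<lambda>i. geom1 (q i))))"
    unfolding Suc.IH by (simp add: map_bind_pmf)
  also have "\<dots> = bind_pmf (active_law n q p t) (\<lambda>M. bind_pmf (survivors q M (p (Suc t) M))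
      (\<lambda>M'. Pi_pmf M' 0 (\<lambda>i. geom1 (q i))))"
  proof (rule bind_pmf_cong[OF refl])
    fix M assume "M \<in> set_pmf (active_law n q p t)"
    then have M: "M \<subseteq> {1..n}" by (rule set_active_law)
    then have fin: "finite M" by (rule finite_subset) simp
    have "map_pmf ?step (Pi_pmf M 0 (\<lambda>i. geom1 (q i))) =
       map_pmf (\<lambda>R i. R i - p (Suc t) M i) (Pi_pmf M 0 (\<lambda>i. geom1 (q i)))"
    proof (rule pmf.map_cong0)
      fix R assume "R \<in> set_pmf (Pi_pmf M 0 (\<lambda>i. geom1 (q i)))"
      then have "{i. 0 < R i} = M" by (rule support_Pi_geom1[OF fin])
      then show "?step R = (\<lambda>i. R i - p (Suc t) M i)" by simp
    qed
    also have "\<dots> = bind_pmf (survivors q M (p (Suc t) M)) (\<lambda>M'. Pi_pmf M' 0 (\<lambda>i. geom1 (q i)))"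
      using M q by (intro demands_memoryless fin) auto
    finally show "map_pmf ?step (Pi_pmf M 0 (\<lambda>i. geom1 (q i))) = \<dots>" .
  qed
  finally show ?case by (simp add: bind_assoc_pmf)
qed

lemma residual_support:
  assumes q: "\<And>i. i \<in> {1..n} \<Longrightarrow> 0 \<le> q i \<and> q i < 1"
  shows "map_pmf (\<lambda>L. {i. 0 < residual p L t i}) (demands n q) = active_law n q p t"
proof -
  have "map_pmf (\<lambda>L. {i. 0 < residual p L t i}) (demands n q) =
      map_pmf (\<lambda>R. {i. 0 < R i}) (map_pmf (\<lambda>L. residual p L t) (demands n q))"
    by (simp add: pmf.map_comp o_def)
  also have "\<dots> = bind_pmf (active_law n q p t) (\<lambda>M. map_pmf (\<lambda>R. {i. 0 < R i}) (Pi_pmf M 0 (\<lambda>i. geom1 (q i))))"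
    by (simp only: residual_law[OF q] map_bind_pmf)
  also have "\<dots> = bind_pmf (active_law n q p t) return_pmf"
  proof (rule bind_pmf_cong[OF refl])
    fix M assume "M \<in> set_pmf (active_law n q p t)"
    then have fin: "finite M" by (meson set_active_law finite_atLeastAtMost finite_subset)
    show "map_pmf (\<lambda>R. {i. 0 < R i}) (Pi_pmf M 0 (\<lambda>i. geom1 (q i))) = return_pmf M"
      \<comment> \<open>The point mass at \<open>M\<close> is written as the image under a constant
        map, so the two maps need to agree only on the support of the product.\<close>
      unfolding map_pmf_const[of M "Pi_pmf M 0 (\<lambda>i. geom1 (q i))", symmetric]
      using fin by (intro pmf.map_cong0) (rule support_Pi_geom1)
  qed
  finally show ?thesis by (simp add: bind_return_pmf')
qed

text \<open>Connects the recursion on residual demands with the cumulative sums of the model. Both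
  claims go through one induction, since each round's allocation depends on the current active
  set.\<close>

lemma residual_eq:
  assumes L: "{i. 0 < L i} = {1..n}"
  shows "{i. 0 < residual p L t i} = active n p L (Suc t)
    \<and> residual p L t = (\<lambda>i. L i - (\<Sum>l = 1..t. p l (active n p L l) i))"
proof (induction t)
  case 0
  show ?case using L by simp
next
  case (Suc t)
  have act: "active n p L (Suc t) = {i. 0 < L i - (\<Sum>l = 1..t. p l (active n p L l) i)}"
    using Suc[THEN conjunct1] unfolding Suc[THEN conjunct2] by (rule sym)
  have 1: "residual p L (Suc t) = (\<lambda>i. L i - (\<Sum>l = 1..Suc t. p l (active n p L l) i))"
    unfolding residual.simps Suc[THEN conjunct1] unfolding Suc[THEN conjunct2] by (simp add: fun_eq_iff)
  moreover have "active n p L (Suc (Suc t)) = {i. 0 < residual p L (Suc t) i}"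
  proof -
    have "active n p L (Suc (Suc t)) = {i \<in> active n p L (Suc t). (\<Sum>l = 1..Suc t. p l (active n p L l) i) < L i}"
      by (rule active.simps)
    also have "\<dots> = {i \<in> {i. 0 < L i - (\<Sum>l = 1..t. p l (active n p L l) i)}. (\<Sum>l = 1..Suc t. p l (active n p L l) i) < L i}"
      by (simp only: act)
    also have "\<dots> = {i. (\<Sum>l = 1..Suc t. p l (active n p L l) i) < L i}"
      by auto
    finally show ?thesis by (simp only: 1 zero_less_diff)
  qed
  ultimately show ?case by metis
qed

text \<open>The active sets decrease, so the number of rounds that start with an active threat is
  the first time at which none is left.\<close>

lemma defusing_time_eq_suminf:
  assumes L: "{i. 0 < L i} = {1..n}" and n: "n \<ge> 1"
  shows "defusing_time n p L = (\<Sum>t. indicator {M. M \<noteq> {}} (active n p L (Suc t)))"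
proof -
  define A where "A t = active n p L (Suc t)" for t
  define T where "T = {t. t \<ge> 1 \<and> (\<forall>i\<in>{1..n}. L i \<le> (\<Sum>l = 1..t. p l (active n p L l) i))}"
  have A: "A t = {i. 0 < L i - (\<Sum>l = 1..t. p l (active n p L l) i)}" for t
    using residual_eq[OF L, of p t, THEN conjunct1]
    unfolding residual_eq[OF L, of p t, THEN conjunct2] A_def by (rule sym)
  have AT: "A t = {} \<longleftrightarrow> t \<in> T" for t
  proof -
    \<comment> \<open>The constraint \<open>t \<ge> 1\<close> in \<open>T\<close> is automatic: with
      \<open>n \<ge> 1\<close> some threat is active at the start.\<close>
    have "1 \<in> A 0" using n by (simp add: A_def)
    then have "t \<ge> 1" if "A t = {}" using that by (cases t) auto
    moreover have "A t = {} \<longleftrightarrow> (\<forall>i. L i \<le> (\<Sum>l = 1..t. p l (active n p L l) i))"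
      unfolding A by (auto simp: not_less)
    moreover have "L i \<le> s" if "i \<notin> {1..n}" for i s using L that by force
    ultimately show ?thesis unfolding T_def by blast
  qed
  have mono: "A t \<subseteq> A s" if "s \<le> t" for s t
  proof -
    have "(\<Sum>l = 1..s. p l (active n p L l) i) \<le> (\<Sum>l = 1..t. p l (active n p L l) i)" for i
      using that by (intro sum_mono2) auto
    then show ?thesis unfolding A by (auto intro: le_less_trans)
  qed
  have "(INF t\<in>T. of_nat t :: ennreal) = (\<Sum>t. indicator {M. M \<noteq> {}} (A t))"
  \<comment> \<open>If some threat is never neutralized, the infimum over the empty set and the sum
    of ones are both infinite.\<close>
  proof (cases "T = {}")
    case True
    then have "(\<Sum>t. indicator {M. M \<noteq> {}} (A t) :: ennreal) = (\<Sum>t. 1)"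
      using AT by (intro suminf_cong) (auto simp: indicator_def)
    also have "\<dots> = \<infinity>"
      by (simp add: suminf_eq_SUP ennreal_SUP_of_nat_eq_top)
    finally show ?thesis using True by simp
  next
    case False
    define m where "m = (LEAST t. t \<in> T)"
    have m: "m \<in> T" using False unfolding m_def by (meson LeastI all_not_in_conv)
    have le: "m \<le> t" if "t \<in> T" for t using that unfolding m_def by (rule Least_le)
    have iff: "A t = {} \<longleftrightarrow> m \<le> t" for t
      using AT le m mono[of m t] by blast
    have "(\<Sum>t. indicator {M. M \<noteq> {}} (A t) :: ennreal) = (\<Sum>t<m. indicator {M. M \<noteq> {}} (A t))"
      using iff by (intro suminf_finite) (auto simp: indicator_def)
    also have "\<dots> = of_nat m" using iff by (simp add: indicator_def)
    also have "\<dots> = (INF t\<in>T. of_nat t)"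
      using m le by (intro antisym INF_greatest INF_lower) auto
    finally show ?thesis by simp
  qed
  then show ?thesis unfolding defusing_time_def T_def[symmetric] A_def .
qed

text \<open>Tail-sum formula for the expectation, with the tail probabilities read off the
  chain.\<close>

lemma expected_time_eq:
  assumes n: "n \<ge> 1" and q: "\<And>i. i \<in> {1..n} \<Longrightarrow> 0 \<le> q i \<and> q i < 1"
  shows "expected_time n q p = (\<Sum>t. emeasure (active_law n q p t) {M. M \<noteq> {}})"
proof -
  have pos: "{i. 0 < L i} = {1..n}" if "L \<in> set_pmf (demands n q)" for L
    using that support_Pi_geom1[of "{1..n}" L q] by (simp add: demands_def)
  have "expected_time n q p =
      (\<integral>\<^sup>+ L. (\<Sum>t. indicator {M. M \<noteq> {}} {i. 0 < residual p L t i}) \<partial>measure_pmf (demands n q))"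
    unfolding expected_time_def
  proof (intro nn_integral_cong_AE AE_pmfI)
    fix L assume "L \<in> set_pmf (demands n q)"
    note L = pos[OF this]
    show "defusing_time n p L = (\<Sum>t. indicator {M. M \<noteq> {}} {i. 0 < residual p L t i})"
      by (simp only: defusing_time_eq_suminf[OF L n] residual_eq[OF L, of p, THEN conjunct1])
  qed
  also have "\<dots> = (\<Sum>t. \<integral>\<^sup>+ L. indicator {M. M \<noteq> {}} {i. 0 < residual p L t i} \<partial>measure_pmf (demands n q))"
    by (intro nn_integral_suminf) simp
  also have "\<dots> = (\<Sum>t. \<integral>\<^sup>+ M. indicator {M. M \<noteq> {}} M \<partial>measure_pmf (active_law n q p t))"
    by (simp only: residual_support[OF q, symmetric] nn_integral_map_pmf)
  finally show ?thesis by simp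
qed

section \<open>Tail estimates for the number of survivors of one round\<close>

lemma finite_set_survivors: "finite M \<Longrightarrow> finite (set_pmf (survivors q M x))"
  by (rule finite_subset[of _ "Pow M"]) (auto dest: set_survivors)

lemma survivors_empty: "survivors q {} x = return_pmf {}"
  by (simp add: survivors_def)

lemma survivors_mean:
  assumes M: "finite M" and q: "\<And>i. i \<in> M \<Longrightarrow> 0 \<le> q i \<and> q i \<le> 1"
  shows "measure_pmf.expectation (survivors q M x) (\<lambda>M'. real (card M')) = (\<Sum>i\<in>M. q i ^ x i)"
proof -
  let ?B = "Pi_pmf M False (\<lambda>i. bernoulli_pmf (q i ^ x i))"
  have fin: "finite (set_pmf ?B)"
    using M by (simp add: set_Pi_pmf finite_PiE_dflt)
  have "measure_pmf.expectation (survivors q M x) (\<lambda>M'. real (card M')) =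
      measure_pmf.expectation ?B (\<lambda>b. \<Sum>i\<in>M. (of_bool (b i) :: real))"
    unfolding survivors_def using M by (simp add: Int_def)
  also have "\<dots> = (\<Sum>i\<in>M. measure_pmf.expectation ?B (\<lambda>b. (of_bool (b i) :: real)))"
    using fin by (intro Bochner_Integration.integral_sum integrable_measure_pmf_finite)
  also have "\<dots> = (\<Sum>i\<in>M. q i ^ x i)"
  proof (rule sum.cong[OF refl])
    fix i assume i: "i \<in> M"
    have "measure_pmf.expectation ?B (\<lambda>b. (of_bool (b i) :: real)) =
        measure_pmf.expectation (map_pmf (\<lambda>b. b i) ?B) (of_bool :: bool \<Rightarrow> real)"
      by simp
    also have "map_pmf (\<lambda>b. b i) ?B = bernoulli_pmf (q i ^ x i)"
      using M i by (subst Pi_pmf_component) auto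
    finally show "measure_pmf.expectation ?B (\<lambda>b. (of_bool (b i) :: real)) = q i ^ x i"
      using q[OF i] by (simp add: power_le_one)
  qed
  finally show ?thesis .
qed

text \<open>By independence the generating function at \<open>1/2\<close> is a product of factors
  \<open>1 - p / 2 \<le> exp (- p / 2)\<close>.\<close>

lemma survivors_half_power_mean:
  assumes M: "finite M" and q: "\<And>i. i \<in> M \<Longrightarrow> 0 \<le> q i \<and> q i \<le> 1"
  shows "measure_pmf.expectation (survivors q M x) (\<lambda>M'. (1/2) ^ card M') \<le> exp (- (\<Sum>i\<in>M. q i ^ x i) / 2)"
proof -
  let ?B = "Pi_pmf M False (\<lambda>i. bernoulli_pmf (q i ^ x i))"
  have "(1/2) ^ card {i\<in>M. b i} = (\<Prod>i\<in>M. if b i then 1/2 else (1::real))" for b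
    using M by (simp add: prod.If_cases Int_def)
  then have "measure_pmf.expectation (survivors q M x) (\<lambda>M'. (1/2) ^ card M') =
      measure_pmf.expectation ?B (\<lambda>b. \<Prod>i\<in>M. if b i then 1/2 else (1::real))"
    unfolding survivors_def by simp
  also have "\<dots> = (\<Prod>i\<in>M. measure_pmf.expectation (bernoulli_pmf (q i ^ x i)) (\<lambda>b. if b then 1/2 else (1::real)))"
    using M by (intro expectation_prod_Pi_pmf integrable_measure_pmf_finite) auto
  also have "\<dots> = (\<Prod>i\<in>M. 1 + - (q i ^ x i) / 2)"
    using q by (intro prod.cong refl) (simp add: power_le_one field_simps)
  also have "\<dots> \<le> (\<Prod>i\<in>M. exp (- (q i ^ x i) / 2))"
  proof (intro prod_mono conjI exp_ge_add_one_self)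
    fix i assume "i \<in> M"
    then have "q i ^ x i \<le> 1" using q by (simp add: power_le_one)
    then show "0 \<le> 1 + - (q i ^ x i) / 2" by simp
  qed
  also have "\<dots> = exp (- (\<Sum>i\<in>M. q i ^ x i) / 2)"
    using M by (simp add: exp_sum[symmetric] sum_negf sum_divide_distrib)
  finally show ?thesis .
qed

lemma survivors_markov:
  assumes M: "finite M" and q: "\<And>i. i \<in> M \<Longrightarrow> 0 \<le> q i \<and> q i \<le> 1" and c: "c > 0"
  shows "measure_pmf.prob (survivors q M x) {M'. c < real (card M')} \<le> (\<Sum>i\<in>M. q i ^ x i) / c"
proof -
  have "measure_pmf.prob (survivors q M x) {M'. c < real (card M')} \<le>
      measure_pmf.prob (survivors q M x) {M' \<in> space (measure_pmf (survivors q M x)). real (card M') \<ge> c}"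
    by (intro measure_pmf.finite_measure_mono) auto
  also have "\<dots> \<le> measure_pmf.expectation (survivors q M x) (\<lambda>M'. real (card M')) / c"
    using c finite_set_survivors[OF M]
    by (intro integral_Markov_inequality_measure[where A="{}"] integrable_measure_pmf_finite) auto
  finally show ?thesis using survivors_mean[OF M q] by simp
qed

text \<open>Exponential Markov inequality with base \<open>1/2\<close>: a mean of at least
  \<open>4 * a\<close> gives \<open>exp (- 2 * a + a * ln 2) \<le> exp (- a)\<close>. The weaker
  bound \<open>1 / a\<close> suffices, because it is later summed along geometrically growing
  levels.\<close>

lemma survivors_chernoff:
  assumes M: "finite M" and q: "\<And>i. i \<in> M \<Longrightarrow> 0 \<le> q i \<and> q i \<le> 1"
    and a: "0 < a" "4 * a \<le> (\<Sum>i\<in>M. q i ^ x i)"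
  shows "measure_pmf.prob (survivors q M x) {M'. real (card M') < a} \<le> 1 / a"
proof -
  have half: "(1/2::real) ^ k = exp (- real k * ln 2)" for k :: nat
    by (simp add: exp_minus exp_of_nat_mult power_one_over inverse_eq_divide mult.commute)
  have "measure_pmf.prob (survivors q M x) {M'. real (card M') < a} \<le>
      measure_pmf.prob (survivors q M x) {M' \<in> space (measure_pmf (survivors q M x)). (1/2) ^ card M' \<ge> exp (- a * ln 2)}"
    unfolding half by (intro measure_pmf.finite_measure_mono) auto
  also have "\<dots> \<le> measure_pmf.expectation (survivors q M x) (\<lambda>M'. (1/2) ^ card M') / exp (- a * ln 2)"
    using finite_set_survivors[OF M]
    by (intro integral_Markov_inequality_measure[where A="{}"] integrable_measure_pmf_finite) auto
  also have "\<dots> \<le> exp (- (\<Sum>i\<in>M. q i ^ x i) / 2) / exp (- a * ln 2)"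
    by (intro divide_right_mono survivors_half_power_mean M q) auto
  also have "\<dots> = exp (- (\<Sum>i\<in>M. q i ^ x i) / 2 + a * ln 2)"
    by (simp add: exp_diff[symmetric])
  also have "\<dots> \<le> exp (- a)"
  proof -
    have "a * ln 2 \<le> a * 1" using a ln_2_less_1 by (intro mult_left_mono) auto
    then have "- (\<Sum>i\<in>M. q i ^ x i) / 2 + a * ln 2 \<le> - a" using a by linarith
    then show ?thesis by simp
  qed
  also have "\<dots> \<le> 1 / a"
  proof -
    have "a \<le> exp a" using exp_ge_add_one_self[of a] by linarith
    then show ?thesis using a by (simp add: exp_minus field_simps)
  qed
  finally show ?thesis .
qed

section \<open>Bounds on the expected time through potentials and levels\<close>

text \<open>Foster-Lyapunov argument: each round with an active threat costs at least one unit of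
  expected potential. The induction is kept in additive form to avoid subtraction in
  \<open>ennreal\<close>.\<close>

lemma expected_time_le_potential:
  fixes V :: "nat set \<Rightarrow> ennreal"
  assumes n: "n \<ge> 1" and q: "\<And>i. i \<in> {1..n} \<Longrightarrow> 0 \<le> q i \<and> q i < 1"
    and drift: "\<And>t M. M \<subseteq> {1..n} \<Longrightarrow> M \<noteq> {} \<Longrightarrow>
      (\<integral>\<^sup>+ M'. V M' \<partial>survivors q M (p (Suc t) M)) + 1 \<le> V M"
  shows "expected_time n q p \<le> V {1..n}"
proof -
  have "(\<integral>\<^sup>+ M. V M \<partial>active_law n q p t) + (\<Sum>s<t. emeasure (active_law n q p s) {M. M \<noteq> {}}) \<le> V {1..n}" for t
  proof (induction t)
    case 0
    show ?case by simp
  next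
    case (Suc t)
    have "(\<integral>\<^sup>+ M. V M \<partial>active_law n q p (Suc t)) + emeasure (active_law n q p t) {M. M \<noteq> {}} =
        (\<integral>\<^sup>+ M. (\<integral>\<^sup>+ M'. V M' \<partial>survivors q M (p (Suc t) M)) + indicator {M. M \<noteq> {}} M \<partial>active_law n q p t)"
      by (simp add: nn_integral_add)
    also have "\<dots> \<le> (\<integral>\<^sup>+ M. V M \<partial>active_law n q p t)"
    proof (intro nn_integral_mono_AE AE_pmfI)
      fix M assume "M \<in> set_pmf (active_law n q p t)"
      then have "M \<subseteq> {1..n}" by (rule set_active_law)
      then show "(\<integral>\<^sup>+ M'. V M' \<partial>survivors q M (p (Suc t) M)) + indicator {M. M \<noteq> {}} M \<le> V M"
        using drift[of M t] by (cases "M = {}") (auto simp: survivors_empty)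
    qed
    finally have "(\<integral>\<^sup>+ M. V M \<partial>active_law n q p (Suc t)) + emeasure (active_law n q p t) {M. M \<noteq> {}}
      \<le> (\<integral>\<^sup>+ M. V M \<partial>active_law n q p t)" .
    from order_trans[OF add_right_mono[OF this] Suc.IH]
    show ?case by (simp only: sum.lessThan_Suc ac_simps)
  qed
  then have "(\<Sum>s<t. emeasure (active_law n q p s) {M. M \<noteq> {}}) \<le> V {1..n}" for t
    by (rule order_trans[OF add_increasing[OF zero_le order_refl]])
  then show ?thesis
    by (subst expected_time_eq[OF n q]) (auto intro!: suminf_le_const)
qed

text \<open>The potential charges \<open>1 / (1 - e j)\<close> for each threshold \<open>c / R (j + 1)\<close> still exceeded by
  the number of active threats; if it lies between \<open>c / R (j + 1)\<close> and \<open>c / R j\<close>, the next round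
  brings it below \<open>c / R (j + 1)\<close> with probability at least \<open>1 - e j\<close>.\<close>

lemma expected_time_le_levels:
  fixes R e :: "nat \<Rightarrow> real"
  assumes n: "n \<ge> 1" and q: "\<And>i. i \<in> {1..n} \<Longrightarrow> 0 \<le> q i \<and> q i < 1"
    and R: "\<And>j. R j \<ge> 0" "real n * R 0 \<le> c" "c < R J"
    and e: "\<And>j. 0 \<le> e j \<and> e j < 1"
    and step: "\<And>t M j. M \<subseteq> {1..n} \<Longrightarrow> M \<noteq> {} \<Longrightarrow> real (card M) * R j \<le> c \<Longrightarrow>
       measure_pmf.prob (survivors q M (p (Suc t) M)) {M'. c < real (card M') * R (Suc j)} \<le> e j"
  shows "expected_time n q p \<le> ennreal (\<Sum>j<J. 1 / (1 - e j))"
proof -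
  define above where "above j = {M::nat set. c < real (card M) * R (Suc j)}" for j
  define w where "w j = 1 / (1 - e j)" for j
  \<comment> \<open>The identity \<open>w j * e j + 1 = w j\<close> says that the expected drop of
    charge \<open>j\<close> pays for exactly one round.\<close>
  have w: "w j \<ge> 0" "w j * e j + 1 = w j" for j
    using e[of j] by (auto simp: w_def field_simps)
  define V where "V M = (\<Sum>j<J. ennreal (w j) * indicator (above j) M)" for M
  have "expected_time n q p \<le> V {1..n}"
  proof (rule expected_time_le_potential[OF n q])
    fix t M assume M: "M \<subseteq> {1..n}" "M \<noteq> {}"
    have fin: "finite M" using M(1) finite_subset by blast
    let ?S = "survivors q M (p (Suc t) M)"
    \<comment> \<open>A discrete intermediate value argument: otherwise induction from level
      \<open>0\<close> would give \<open>card M * R J \<le> c\<close>, although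
      \<open>c < R J\<close> and \<open>M\<close> is nonempty.\<close>
    have "\<exists>j<J. real (card M) * R j \<le> c \<and> c < real (card M) * R (Suc j)"
    proof (rule ccontr)
      assume *: "\<not> ?thesis"
      have "real (card M) * R j \<le> c" if "j \<le> J" for j
        using that
      proof (induction j)
        case 0
        have "real (card M) * R 0 \<le> real n * R 0"
          using R(1) card_mono[OF _ M(1)] by (intro mult_right_mono) auto
        then show ?case using R(2) by simp
      next
        case (Suc j)
        then show ?case using * by force
      qed
      from this[of J] have "real (card M) * R J \<le> c" by simp
      moreover have "1 * R J \<le> real (card M) * R J"
        using R(1) M(2) fin by (intro mult_right_mono) (auto simp: Suc_le_eq card_gt_0_iff)
      ultimately show False using R(3) by simp
    qed
    then obtain j where j: "j < J" "real (card M) * R j \<le> c" "M \<in> above j"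
      by (auto simp: above_def)
    have pj: "emeasure ?S (above j) \<le> ennreal (e j)"
      using step[OF M j(2), of t] by (simp add: above_def measure_pmf.emeasure_eq_measure ennreal_leI)
    \<comment> \<open>The active set only shrinks, so the other charges never increase.\<close>
    have pi: "emeasure ?S (above i) \<le> indicator (above i) M" for i
    proof (cases "M \<in> above i")
      case False
      have "M' \<notin> above i" if "M' \<in> set_pmf ?S" for M'
      proof -
        have "real (card M') * R (Suc i) \<le> real (card M) * R (Suc i)"
          using card_mono[OF fin set_survivors[OF fin that]] R(1) by (intro mult_right_mono) auto
        then show ?thesis using False by (auto simp: above_def)
      qed
      then have "emeasure ?S (above i) = 0"
        by (auto simp: measure_pmf.emeasure_eq_measure measure_pmf_zero_iff)
      then show ?thesis by simp
    qed (simp add: measure_pmf.emeasure_le_1)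
    have "(\<integral>\<^sup>+ M'. V M' \<partial>?S) + 1 = (\<Sum>i<J. ennreal (w i) * emeasure ?S (above i)) + 1"
      unfolding V_def by (subst nn_integral_sum) (simp_all add: nn_integral_cmult)
    also have "\<dots> = (\<Sum>i\<in>{..<J}-{j}. ennreal (w i) * emeasure ?S (above i)) + (ennreal (w j) * emeasure ?S (above j) + 1)"
      using j(1) by (subst sum.remove[of _ j]) (auto simp: algebra_simps)
    also have "\<dots> \<le> (\<Sum>i\<in>{..<J}-{j}. ennreal (w i) * indicator (above i) M) + (ennreal (w j) * ennreal (e j) + 1)"
      by (intro add_mono sum_mono mult_left_mono pi pj) auto
    also have "ennreal (w j) * ennreal (e j) + 1 = ennreal (w j) * indicator (above j) M"
    proof -
      have "ennreal (w j) * ennreal (e j) + 1 = ennreal (w j * e j + 1)"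
        using w(1) e by (simp add: ennreal_mult)
      then show ?thesis using j(3) w(2) by simp
    qed
    also have "(\<Sum>i\<in>{..<J}-{j}. ennreal (w i) * indicator (above i) M) + ennreal (w j) * indicator (above j) M = V M"
      unfolding V_def using j(1) by (subst (2) sum.remove[of _ j]) (auto simp: algebra_simps)
    finally show "(\<integral>\<^sup>+ M'. V M' \<partial>?S) + 1 \<le> V M" .
  qed
  also have "V {1..n} \<le> (\<Sum>j<J. ennreal (w j))"
    unfolding V_def by (intro sum_mono) (auto simp: indicator_def)
  also have "\<dots> = ennreal (\<Sum>j<J. 1 / (1 - e j))"
    using w(1) by (simp add: w_def)
  finally show ?thesis .
qed

text \<open>Union bound over the rounds: the chain can be below \<open>c / S t\<close> only if some
  earlier round made an excessive jump. A chain that is not below has not finished, which bounds the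
  tail sum from below.\<close>

lemma expected_time_ge_levels:
  fixes S d :: "nat \<Rightarrow> real"
  assumes n: "n \<ge> 1" and q: "\<And>i. i \<in> {1..n} \<Longrightarrow> 0 \<le> q i \<and> q i < 1"
    and c: "0 < c" "c \<le> real n * S 0" and d: "\<And>t. 0 \<le> d t"
    and step: "\<And>t M. M \<subseteq> {1..n} \<Longrightarrow> c \<le> real (card M) * S t \<Longrightarrow>
       measure_pmf.prob (survivors q M (p (Suc t) M)) {M'. real (card M') * S (Suc t) < c} \<le> d (Suc t)"
  shows "ennreal (\<Sum>t<N. 1 - (\<Sum>j=1..t. d j)) \<le> expected_time n q p"
proof -
  define low where "low t = {M::nat set. real (card M) * S t < c}" for t
  have bad: "emeasure (active_law n q p t) (low t) \<le> ennreal (\<Sum>j=1..t. d j)" for t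
  proof (induction t)
    case 0
    show ?case using c by (simp add: low_def indicator_def)
  next
    case (Suc t)
    have "emeasure (active_law n q p (Suc t)) (low (Suc t)) =
       (\<integral>\<^sup>+ M. emeasure (survivors q M (p (Suc t) M)) (low (Suc t)) \<partial>active_law n q p t)"
      by simp
    also have "\<dots> \<le> (\<integral>\<^sup>+ M. indicator (low t) M + ennreal (d (Suc t)) \<partial>active_law n q p t)"
    proof (intro nn_integral_mono_AE AE_pmfI)
      fix M assume M: "M \<in> set_pmf (active_law n q p t)"
      show "emeasure (survivors q M (p (Suc t) M)) (low (Suc t)) \<le> indicator (low t) M + ennreal (d (Suc t))"
      proof (cases "M \<in> low t")
        case True
        then show ?thesis
          by (intro order_trans[OF measure_pmf.emeasure_le_1]) simp
      next
        case False
        then show ?thesis using step[OF set_active_law[OF M], of t]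
          by (auto simp: low_def measure_pmf.emeasure_eq_measure intro!: ennreal_leI)
      qed
    qed
    also have "\<dots> = emeasure (active_law n q p t) (low t) + ennreal (d (Suc t))"
      by (simp add: nn_integral_add)
    also have "\<dots> \<le> ennreal (\<Sum>j=1..t. d j) + ennreal (d (Suc t))"
      by (intro add_right_mono Suc.IH)
    finally show ?case using d by (simp add: sum_nonneg flip: ennreal_plus)
  qed
  have "ennreal (\<Sum>t<N. 1 - (\<Sum>j=1..t. d j)) \<le> ennreal (\<Sum>t<N. measure_pmf.prob (active_law n q p t) {M. M \<noteq> {}})"
  proof (intro ennreal_leI sum_mono)
    fix t
    have "measure_pmf.prob (active_law n q p t) (low t) \<le> (\<Sum>j=1..t. d j)"
      using bad[of t] d by (simp add: measure_pmf.emeasure_eq_measure sum_nonneg)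
    then have "1 - (\<Sum>j=1..t. d j) \<le> measure_pmf.prob (active_law n q p t) (- low t)"
      using measure_pmf.prob_compl[of "low t" "active_law n q p t"] by (simp add: Compl_eq_Diff_UNIV)
    \<comment> \<open>The empty set lies in \<open>low t\<close> because
      \<open>c > 0\<close>.\<close>
    also have "\<dots> \<le> measure_pmf.prob (active_law n q p t) {M. M \<noteq> {}}"
      using c by (intro measure_pmf.finite_measure_mono) (auto simp: low_def)
    finally show "1 - (\<Sum>j=1..t. d j) \<le> measure_pmf.prob (active_law n q p t) {M. M \<noteq> {}}" .
  qed
  also have "\<dots> = (\<Sum>t<N. emeasure (active_law n q p t) {M. M \<noteq> {}})"
    by (simp add: measure_pmf.emeasure_eq_measure)
  also have "\<dots> \<le> expected_time n q p"
    by (subst expected_time_eq[OF n q]) (auto intro!: sum_le_suminf)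
  finally show ?thesis .
qed

section \<open>Expected fraction of survivors under fair and arbitrary allocations\<close>

text \<open>Shares differ by at most one, so no share is more than one below the average.\<close>

lemma fair_ge:
  assumes x: "fair C M x" and M: "finite M" and i: "i \<in> M"
  shows "real C / real (card M) - 1 \<le> real (x i)"
proof -
  have "x j \<le> x i + 1" if "j \<in> M" for j
    using x i that unfolding fair_def by force
  then have "(\<Sum>j\<in>M. x j) \<le> (\<Sum>j\<in>M. x i + 1)" by (intro sum_mono)
  then have "C \<le> card M * (x i + 1)" using x by (simp add: fair_def)
  then have "real C \<le> real (card M) * (real (x i) + 1)"
    by (metis of_nat_1 of_nat_add of_nat_le_iff of_nat_mult)
  moreover have "card M > 0" using M i card_gt_0_iff by blast
  ultimately show ?thesis by (simp add: field_simps)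
qed

lemma fair_sum_le_powr:
  assumes x: "fair C M x" and M: "finite M" and u: "0 < u" "u < 1"
    and q: "\<And>i. i \<in> M \<Longrightarrow> 0 \<le> q i \<and> q i \<le> u"
  shows "(\<Sum>i\<in>M. q i ^ x i) \<le> real (card M) * u powr (real C / real (card M) - 1)"
proof -
  have "q i ^ x i \<le> u powr (real C / real (card M) - 1)" if "i \<in> M" for i
  proof -
    have "q i ^ x i \<le> u ^ x i" using q[OF that] by (intro power_mono) auto
    also have "\<dots> = u powr real (x i)" using u by (simp add: powr_realpow)
    also have "\<dots> \<le> u powr (real C / real (card M) - 1)"
      using fair_ge[OF x M that] u by (intro powr_mono') auto
    finally show ?thesis .
  qed
  then have "(\<Sum>i\<in>M. q i ^ x i) \<le> (\<Sum>i\<in>M. u powr (real C / real (card M) - 1))"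
    by (intro sum_mono)
  then show ?thesis by simp
qed

text \<open>Covers small ratios \<open>C / card M\<close>, where the exponential bound may exceed
  the trivial one. Only the number of threats that receive at least one effector matters
  here.\<close>

lemma fair_sum_le_linear:
  assumes x: "fair C M x" and M: "finite M" and u: "0 < u" "u < 1"
    and q: "\<And>i. i \<in> M \<Longrightarrow> 0 \<le> q i \<and> q i \<le> u"
    and a: "a \<le> 1" "a * real (card M) \<le> real C"
  shows "(\<Sum>i\<in>M. q i ^ x i) \<le> real (card M) * (1 - (1 - u) * a)"
proof -
  have "q i ^ x i \<le> 1 - (1 - u) * real (min (x i) 1)" if "i \<in> M" for i
  proof (cases "x i")
    case (Suc k)
    have "q i ^ x i \<le> u ^ x i" using q[OF that] by (intro power_mono) auto
    also have "\<dots> = u * u ^ k" by (simp add: Suc)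
    also have "\<dots> \<le> u * 1" using u by (intro mult_left_mono power_le_one) auto
    finally show ?thesis using Suc by simp
  qed simp
  then have "(\<Sum>i\<in>M. q i ^ x i) \<le> (\<Sum>i\<in>M. 1 - (1 - u) * real (min (x i) 1))"
    by (intro sum_mono)
  also have "\<dots> = real (card M) - (1 - u) * real (\<Sum>i\<in>M. min (x i) 1)"
    by (simp add: sum_subtractf sum_distrib_left)
  also have "\<dots> \<le> real (card M) - (1 - u) * (a * real (card M))"
  proof -
    have "a * real (card M) \<le> real (\<Sum>i\<in>M. min (x i) 1)"
    \<comment> \<open>Either some threat gets two effectors, and fairness gives everyone at least
      one, or all \<open>C\<close> effectors go to different threats.\<close>
    proof (cases "\<exists>i\<in>M. x i \<ge> 2")
      case True
      then obtain i where i: "i \<in> M" "x i \<ge> 2" by blast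
      have "x j \<ge> 1" if "j \<in> M" for j
        using x i that unfolding fair_def by force
      then have "(\<Sum>i\<in>M. min (x i) 1) = (\<Sum>i\<in>M. 1)" by (intro sum.cong) auto
      then show ?thesis using a mult_right_mono[OF a(1), of "real (card M)"] by simp
    next
      case False
      then have "(\<Sum>i\<in>M. min (x i) 1) = (\<Sum>i\<in>M. x i)" by (intro sum.cong) force+
      then show ?thesis using a x by (simp add: fair_def)
    qed
    then show ?thesis using u by (simp add: mult_left_mono)
  qed
  finally show ?thesis by (simp add: algebra_simps)
qed

text \<open>Summation of the tangent line bounds for the convex function \<open>y \<mapsto> l powr y\<close> at the average allocation.\<close>

lemma sum_power_ge_powr_average:
  fixes x :: "'a \<Rightarrow> nat"
  assumes M: "finite M" "M \<noteq> {}" and l: "0 < l"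
    and q: "\<And>i. i \<in> M \<Longrightarrow> l \<le> q i" and x: "(\<Sum>i\<in>M. x i) = C"
  shows "real (card M) * l powr (real C / real (card M)) \<le> (\<Sum>i\<in>M. q i ^ x i)"
proof -
  define y where "y = real C / real (card M)"
  have m: "real (card M) > 0" using M by (simp add: card_gt_0_iff)
  have "(\<Sum>i\<in>M. l powr y * (1 + (real (x i) - y) * ln l)) \<le> (\<Sum>i\<in>M. q i ^ x i)"
  proof (rule sum_mono)
    fix i assume i: "i \<in> M"
    have "l powr y * (1 + (real (x i) - y) * ln l) \<le> l powr y * exp ((real (x i) - y) * ln l)"
      by (intro mult_left_mono exp_ge_add_one_self) auto
    also have "\<dots> = l ^ x i"
      using l by (simp add: powr_def exp_add[symmetric] algebra_simps flip: powr_realpow)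
    also have "\<dots> \<le> q i ^ x i" using q[OF i] l by (intro power_mono) auto
    finally show "l powr y * (1 + (real (x i) - y) * ln l) \<le> q i ^ x i" .
  qed
  moreover have "(\<Sum>i\<in>M. l powr y * (1 + (real (x i) - y) * ln l)) =
      l powr y * (real (card M) + (real (\<Sum>i\<in>M. x i) - real (card M) * y) * ln l)"
    by (simp add: sum_distrib_left[symmetric] sum.distrib sum_distrib_right[symmetric] sum_subtractf)
  moreover have "real (\<Sum>i\<in>M. x i) - real (card M) * y = 0"
    using m x by (simp add: y_def)
  ultimately show ?thesis by (simp add: y_def mult.commute)
qed

section \<open>Fair allocations and the deterministic fair policies\<close>

text \<open>Induction on the capacity: an additional effector goes to a threat with the smallest
  share.\<close>

lemma fair_exists: "finite M \<Longrightarrow> M \<noteq> {} \<Longrightarrow> \<exists>x. fair C M x"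
proof (induction C)
  case 0
  then show ?case by (intro exI[of _ "\<lambda>_. 0"]) (simp add: fair_def)
next
  case (Suc C)
  then obtain x where x: "fair C M x" by blast
  obtain k where k: "k \<in> M" "\<And>j. j \<in> M \<Longrightarrow> x k \<le> x j"
    using Suc.prems ex_min_if_finite[of "x ` M"] by (metis arg_min_if_finite(1) arg_min_least)
  define y where "y = x(k := Suc (x k))"
  have "(\<Sum>i\<in>M. y i) = Suc C"
    using x k(1) Suc.prems unfolding fair_def y_def
    by (simp add: sum.remove[of M k])
  moreover have "\<bar>int (y i) - int (y j)\<bar> \<in> {0, 1}" if "i \<in> M" "j \<in> M" for i j
  proof -
    have "\<bar>int (x i) - int (x j)\<bar> \<in> {0, 1}" using x that unfolding fair_def by blast
    then show ?thesis using k(2)[OF that(1)] k(2)[OF that(2)] by (auto simp: y_def)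
  qed
  moreover have "y i = 0" if "i \<notin> M" for i
    using x k(1) that unfolding fair_def y_def by auto
  ultimately show ?case unfolding fair_def by blast
qed

lemma finite_fair: "finite M \<Longrightarrow> finite {x. fair C M x}"
proof (rule finite_subset)
  assume M: "finite M"
  show "{x. fair C M x} \<subseteq> PiE_dflt M 0 (\<lambda>_. {..C})"
    using member_le_sum[OF _ _ M] by (fastforce simp: fair_def PiE_dflt_def)
  show "finite (PiE_dflt M 0 (\<lambda>_. {..C}))" using M by (intro finite_PiE_dflt) auto
qed

text \<open>Existence and finiteness are what \<open>pmf_of_set\<close> requires for its support to
  be the given set.\<close>

lemma set_fair_allocation_policy:
  assumes "M \<subseteq> {1..n}" "M \<noteq> {}"
  shows "set_pmf (fair_allocation_policy C t M) = {x. fair C M x}"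
proof -
  have "finite M" using assms finite_subset by blast
  then show ?thesis using assms fair_exists[of M C] finite_fair[of M C]
    by (simp add: fair_allocation_policy_def)
qed

text \<open>The possible outcomes of the random draws. All estimates are proved for these
  deterministic policies and then averaged.\<close>

definition fair_policy :: "nat \<Rightarrow> nat \<Rightarrow> policy \<Rightarrow> bool" where
  "fair_policy n C p \<longleftrightarrow> (\<forall>t. \<forall>M\<subseteq>{1..n}. p t M \<in> set_pmf (fair_allocation_policy C t M))"

lemma fair_policyD: "fair_policy n C p \<Longrightarrow> M \<subseteq> {1..n} \<Longrightarrow> M \<noteq> {} \<Longrightarrow> fair C M (p t M)"
  unfolding fair_policy_def using set_fair_allocation_policy by blast

lemma fair_policy_in_policies:
  assumes "fair_policy n C p"
  shows "p \<in> policies n C"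
proof -
  have "(\<Sum>i\<in>{1..n}. p t M i) \<le> C \<and> (M \<noteq> {} \<longrightarrow> (\<Sum>i\<in>M. p t M i) = C)" if M: "M \<subseteq> {1..n}" for t M
  proof (cases "M = {}")
    case True
    then have "p t M = (\<lambda>_. 0)"
      using assms M unfolding fair_policy_def fair_allocation_policy_def by force
    then show ?thesis using True by simp
  next
    case False
    then have f: "fair C M (p t M)" using fair_policyD[OF assms M] by simp
    then have "(\<Sum>i\<in>{1..n}. p t M i) = (\<Sum>i\<in>M. p t M i)"
      using M by (intro sum.mono_neutral_right) (auto simp: fair_def)
    then show ?thesis using f by (simp add: fair_def)
  qed
  then show ?thesis by (simp add: policies_def)
qed

section \<open>Measurability and averaging over the random draws\<close>

lemma prob_space_policy_draws: "prob_space (policy_draws n r)"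
  unfolding policy_draws_def by (intro prob_space_PiM measure_pmf.prob_space_axioms)

lemma AE_policy_draws:
  "AE p in policy_draws n r. \<forall>t. \<forall>M\<subseteq>{1..n}. p t M \<in> set_pmf (r t M)"
  unfolding AE_all_countable
proof
  fix t
  have "AE f in measure_pmf (Pi_pmf (Pow {1..n}) (\<lambda>_. 0) (r t)). \<forall>M\<subseteq>{1..n}. f M \<in> set_pmf (r t M)"
    by (rule AE_pmfI) (auto simp: set_Pi_pmf PiE_dflt_def)
  then show "AE p in policy_draws n r. \<forall>M\<subseteq>{1..n}. p t M \<in> set_pmf (r t M)"
    unfolding policy_draws_def
    by (intro AE_PiM_component[where i=t] measure_pmf.prob_space_axioms) auto
qed

lemma measurable_policy_component:
  "(\<lambda>p. p t M i) \<in> measurable (policy_draws n r) (count_space UNIV)"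
proof -
  have "(\<lambda>p. p t) \<in> measurable (policy_draws n r) (measure_pmf (Pi_pmf (Pow {1..n}) (\<lambda>_. 0) (r t)))"
    unfolding policy_draws_def by (rule measurable_component_singleton) simp
  from measurable_compose[OF this, of "\<lambda>f. f M i"] show ?thesis by simp
qed

lemma measurable_demands_component:
  "(\<lambda>L. L i) \<in> measurable (measure_pmf P) (count_space UNIV)"
  by simp

lemma pred_less_nat:
  fixes f g :: "'a \<Rightarrow> nat"
  assumes "f \<in> measurable N (count_space UNIV)" "g \<in> measurable N (count_space UNIV)"
  shows "Measurable.pred N (\<lambda>w. f w < g w)"
proof -
  have [measurable]: "f \<in> borel_measurable N" "g \<in> borel_measurable N"
    by (auto intro: measurable_compose[OF assms(1)] measurable_compose[OF assms(2)])
  show ?thesis by measurable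
qed

lemma active_subset: "active n p L t \<subseteq> {1..n}"
  by (induction t rule: induct_nat_012) auto

text \<open>Strong induction on the round: the active set takes finitely many values, so playing the
  draw that belongs to it is a countable case distinction between measurable components.\<close>

lemma measurable_allocation:
  fixes P :: "(nat \<Rightarrow> nat) pmf" and n :: nat and r :: randomized_policy
  defines "N \<equiv> measure_pmf P \<Otimes>\<^sub>M policy_draws n r"
  shows "(\<lambda>(L, p). p t (active n p L t) i) \<in> measurable N (count_space UNIV)"
proof -
  note [[simproc del: measurable]]
  have L: "(\<lambda>w. fst w i) \<in> measurable N (count_space UNIV)" for i
    unfolding N_def by (rule measurable_compose[OF measurable_fst measurable_demands_component])
  have p: "(\<lambda>w. snd w t M i) \<in> measurable N (count_space UNIV)" for t M i
    unfolding N_def by (rule measurable_compose[OF measurable_snd measurable_policy_component])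
  have alloc: "(\<lambda>w. snd w t (active n (snd w) (fst w) t) i) \<in> measurable N (count_space UNIV)"
    if "(\<lambda>w. active n (snd w) (fst w) t) \<in> measurable N (count_space (Pow {1..n}))" for t i
    by (rule measurable_compose_countable'[OF p that]) (simp add: countable_finite)
  have act: "(\<lambda>w. active n (snd w) (fst w) t) \<in> measurable N (count_space (Pow {1..n}))" for t
  proof (induction t rule: less_induct)
    case (less t)
    consider "t = 0" | "t = 1" | s where "t = Suc (Suc s)"
      by (cases t; cases "t - 1") auto
    then show ?case
    proof cases
      case (3 s)
      have a: "(\<lambda>w. snd w l (active n (snd w) (fst w) l) i) \<in> measurable N (count_space UNIV)" if "l \<le> Suc s" for l i
        using that 3 by (intro alloc less.IH) simp
      have sum: "(\<lambda>w. \<Sum>l = 1..Suc s. snd w l (active n (snd w) (fst w) l) i) \<in> measurable N (count_space UNIV)" for i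
        by (rule measurable_sum_nat, rule a) simp
      have A: "(\<lambda>w. active n (snd w) (fst w) (Suc s)) \<in> measurable N (count_space (Pow {1..n}))"
        using 3 by (intro less.IH) simp
      have mem: "{w \<in> space N. i \<in> active n (snd w) (fst w) t} \<in> sets N" for i
      proof -
        have "{w \<in> space N. i \<in> active n (snd w) (fst w) (Suc s)} =
          (\<lambda>w. active n (snd w) (fst w) (Suc s)) -` {M. M \<subseteq> {1..n} \<and> i \<in> M} \<inter> space N"
          using active_subset[of n _ _ "Suc s"] by blast
        also have "\<dots> \<in> sets N" by (rule measurable_sets[OF A]) auto
        finally have "Measurable.pred N (\<lambda>w. i \<in> active n (snd w) (fst w) (Suc s))"
          unfolding pred_def .
        from pred_intros_logic(3)[OF this pred_less_nat[OF sum L]]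
        show ?thesis unfolding 3 active.simps mem_Collect_eq pred_def .
      qed
      have "(\<lambda>w. active n (snd w) (fst w) t) -` {M} \<inter> space N \<in> sets N" if "M \<in> Pow {1..n}" for M
      proof -
        have "(\<lambda>w. active n (snd w) (fst w) t) -` {M} \<inter> space N =
          {w \<in> space N. \<forall>i\<in>{1..n}. i \<in> active n (snd w) (fst w) t \<longleftrightarrow> i \<in> M}"
          using active_subset[of n _ _ t] that by fast
        also have "\<dots> \<in> sets N"
          using mem unfolding pred_def[symmetric]
          by (intro pred_intros_finite finite_atLeastAtMost pred_intros_logic(6) measurable_const) auto
        finally show ?thesis .
      qed
      moreover have "(\<lambda>w. active n (snd w) (fst w) t) \<in> space N \<rightarrow> Pow {1..n}"
        using active_subset by blast
      moreover have "finite (Pow {1..n})" by simp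
      ultimately show ?thesis by (simp only: measurable_count_space_eq2) blast
    qed (simp_all add: measurable_const)
  qed
  show "(\<lambda>(L, p). p t (active n p L t) i) \<in> measurable N (count_space UNIV)"
    using alloc[OF act] by (simp add: case_prod_beta')
qed

lemma measurable_defusing_time:
  fixes P :: "(nat \<Rightarrow> nat) pmf"
  shows "(\<lambda>(L, p). defusing_time n p L) \<in> borel_measurable (measure_pmf P \<Otimes>\<^sub>M policy_draws n r)"
proof -
  note [[simproc del: measurable]]
  let ?N = "measure_pmf P \<Otimes>\<^sub>M policy_draws n r"
  have L: "(\<lambda>w. fst w i) \<in> measurable ?N (count_space UNIV)" for i
    by (rule measurable_compose[OF measurable_fst measurable_demands_component])
  have a: "(\<lambda>w. snd w l (active n (snd w) (fst w) l) i) \<in> measurable ?N (count_space UNIV)" for l i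
    using measurable_allocation[of l n i P r] by (simp add: case_prod_beta')
  have s: "(\<lambda>w. \<Sum>l = 1..t. snd w l (active n (snd w) (fst w) l) i) \<in> measurable ?N (count_space UNIV)" for t i
    by (rule measurable_sum_nat, rule a)
  \<comment> \<open>The value \<open>\<infinity>\<close> at unsuccessful times makes the index set
    independent of \<open>w\<close>, leaving a countable infimum.\<close>
  have "(\<lambda>w. defusing_time n (snd w) (fst w)) =
    (\<lambda>w. INF t. if t \<ge> 1 \<and> (\<forall>i\<in>{1..n}. \<not> (\<Sum>l = 1..t. snd w l (active n (snd w) (fst w) l) i) < fst w i) then of_nat t else \<infinity>)"
    unfolding defusing_time_def
  proof (intro ext antisym INF_greatest, goal_cases)
    case (1 w t)
    then show ?case by (auto intro!: INF_lower simp: not_less)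
  next
    case (2 w t)
    then show ?case by (intro INF_lower2[of t]) (auto simp: not_less)
  qed
  also have "\<dots> \<in> borel_measurable ?N"
  proof (rule borel_measurable_INF)
    fix t
    have "Measurable.pred ?N (\<lambda>w. t \<ge> 1 \<and> (\<forall>i\<in>{1..n}. \<not> (\<Sum>l = 1..t. snd w l (active n (snd w) (fst w) l) i) < fst w i))"
      by (intro pred_intros_logic(3) pred_intros_finite(3) pred_intros_logic(2) pred_less_nat[OF s L]
          finite_atLeastAtMost measurable_const) simp
    then show "(\<lambda>w. if t \<ge> 1 \<and> (\<forall>i\<in>{1..n}. \<not> (\<Sum>l = 1..t. snd w l (active n (snd w) (fst w) l) i) < fst w i)
        then of_nat t else \<infinity> :: ennreal) \<in> borel_measurable ?N"
      unfolding pred_def by (intro measurable_If measurable_const) simp_all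
  qed simp
  finally show ?thesis by (simp add: case_prod_beta')
qed

text \<open>Tonelli: with the draws fixed first, the randomized policy is a mixture of deterministic
  ones.\<close>

lemma expected_time_randomized_eq:
  "expected_time_randomized n q r = (\<integral>\<^sup>+ p. expected_time n q p \<partial>policy_draws n r)"
proof -
  interpret p: prob_space "policy_draws n r" by (rule prob_space_policy_draws)
  interpret pair_sigma_finite "measure_pmf (demands n q)" "policy_draws n r" ..
  show ?thesis
    unfolding expected_time_randomized_def expected_time_def
    using nn_integral_snd[OF measurable_defusing_time[of n "demands n q" r]] by simp
qed

section \<open>Upper levels and the expected time of fair policies\<close>

text \<open>This is \<open>\<epsilon>(r)\<close> of the overview. The square roots let Markov's
  inequality split the surviving fraction into one factor for the next level and one for the failure
  probability.\<close>

definition survival_bound :: "real \<Rightarrow> real \<Rightarrow> real \<Rightarrow> real" where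
  "survival_bound u a r = min (sqrt (1 - (1 - u) * a)) (sqrt u powr (r - 1))"

primrec upper_level :: "real \<Rightarrow> real \<Rightarrow> real \<Rightarrow> nat \<Rightarrow> real" where
  "upper_level u a r 0 = r"
| "upper_level u a r (Suc k) = upper_level u a r k / survival_bound u a (upper_level u a r k)"

text \<open>These are the levels \<open>S\<close> of the overview; the factor \<open>4\<close> is
  the margin that \<open>survivors_chernoff\<close> asks for.\<close>

primrec lower_level :: "real \<Rightarrow> real \<Rightarrow> nat \<Rightarrow> real" where
  "lower_level l r 0 = r"
| "lower_level l r (Suc k) = 4 * lower_level l r k * l powr (- lower_level l r k)"

context
  fixes u a :: real
  assumes u: "0 < u" "u < 1" and a: "0 < a" "a \<le> 1"
begin

lemma contraction_bounds: "0 < 1 - (1 - u) * a" "1 - (1 - u) * a < 1"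
proof -
  have "(1 - u) * a \<le> (1 - u) * 1" using u a by (intro mult_left_mono) auto
  also have "\<dots> < 1" using u by simp
  finally show "0 < 1 - (1 - u) * a" by simp
  show "1 - (1 - u) * a < 1" using u a by simp
qed

lemma survival_bound_pos: "0 < survival_bound u a r"
  using contraction_bounds u by (simp add: survival_bound_def)

lemma survival_bound_le: "survival_bound u a r \<le> sqrt (1 - (1 - u) * a)"
  by (simp add: survival_bound_def)

lemma survival_bound_less_1: "survival_bound u a r < 1"
  using survival_bound_le[of r] contraction_bounds by (smt (verit) real_sqrt_lt_1_iff)

lemma survival_bound_antimono: "r \<le> r' \<Longrightarrow> survival_bound u a r' \<le> survival_bound u a r"
  unfolding survival_bound_def using u by (intro min.mono order_refl powr_mono') auto

lemma survival_bound_sq: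
  "(survival_bound u a r)\<^sup>2 = min (1 - (1 - u) * a) (u powr (r - 1))"
proof -
  have 1: "(sqrt u powr (r - 1))\<^sup>2 = u powr (r - 1)"
    using u by (simp add: powr_half_sqrt[symmetric] powr_powr power2_eq_square powr_add[symmetric])
  have 2: "(sqrt (1 - (1 - u) * a))\<^sup>2 = 1 - (1 - u) * a"
    using contraction_bounds by simp
  have "(min x y)\<^sup>2 = min (x\<^sup>2) (y\<^sup>2)" if "0 \<le> x" "0 \<le> y" for x y :: real
    using that by (auto simp: min_def power_mono intro: antisym power2_le_imp_le)
  then show ?thesis
    unfolding survival_bound_def using 1 2 contraction_bounds u by (simp add: less_imp_le)
qed

lemma upper_level_pos: "0 < r \<Longrightarrow> 0 < upper_level u a r k"
  by (induction k) (use survival_bound_pos in auto)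

text \<open>Every step divides by at most \<open>sqrt (1 - (1 - u) * a)\<close>, so the levels grow
  at least geometrically.\<close>

lemma upper_level_ge:
  assumes r: "0 < r"
  shows "r \<le> upper_level u a r k * sqrt (1 - (1 - u) * a) ^ k"
proof (induction k)
  case (Suc k)
  let ?R = "upper_level u a r k" and ?\<rho> = "sqrt (1 - (1 - u) * a)"
  have "?R \<le> upper_level u a r (Suc k) * ?\<rho>"
    using mult_left_mono[OF survival_bound_le, of ?R ?R] survival_bound_pos[of ?R] upper_level_pos[OF r, of k]
    by (simp add: field_simps)
  from mult_right_mono[OF this, of "?\<rho> ^ k"] Suc show ?case
    using contraction_bounds by (simp add: algebra_simps)
qed simp

lemma fair_policy_expected_time_le:
  assumes n: "n \<ge> 1" and C: "C \<ge> 1" and q: "\<And>i. i \<in> {1..n} \<Longrightarrow> 0 \<le> q i \<and> q i \<le> u"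
    and aC: "a * real n \<le> real C" and p: "fair_policy n C p"
    and J: "real C < upper_level u a (real C / real n) J"
  shows "expected_time n q p \<le>
    ennreal (\<Sum>j<J. 1 / (1 - survival_bound u a (upper_level u a (real C / real n) j)))"
proof (rule expected_time_le_levels[OF n])
  let ?R = "upper_level u a (real C / real n)"
  have R: "?R j > 0" for j using n C by (intro upper_level_pos) simp
  show "0 \<le> q i \<and> q i < 1" if "i \<in> {1..n}" for i using q[OF that] u by simp
  show "0 \<le> ?R j" for j using R[of j] by simp
  show "real n * ?R 0 \<le> real C" using n by simp
  show "real C < ?R J" by (rule J)
  show "0 \<le> survival_bound u a (?R j) \<and> survival_bound u a (?R j) < 1" for j
    using survival_bound_pos survival_bound_less_1 by (simp add: less_imp_le)
  fix t M j
  assume M: "M \<subseteq> {1..n}" "M \<noteq> {}" and Mj: "real (card M) * ?R j \<le> real C"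
  let ?e = "survival_bound u a (?R j)" and ?x = "p (Suc t) M"
  have fin: "finite M" using M(1) finite_subset by blast
  have m: "real (card M) > 0" using fin M(2) by (simp add: card_gt_0_iff)
  have x: "fair C M ?x" using fair_policyD[OF p M] .
  have qM: "0 \<le> q i \<and> q i \<le> u" if "i \<in> M" for i using q M that by blast
  have "a * real (card M) \<le> a * real n"
    using card_mono[OF _ M(1)] a by (intro mult_left_mono) auto
  then have aM: "a * real (card M) \<le> real C" using aC by simp
  have e: "0 < ?e" by (rule survival_bound_pos)
  have "(\<Sum>i\<in>M. q i ^ ?x i) \<le> real (card M) * (survival_bound u a (real C / real (card M)))\<^sup>2"
    using fair_sum_le_linear[OF x fin u qM a(2) aM] fair_sum_le_powr[OF x fin u qM]
    unfolding survival_bound_sq by (simp add: min_def)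
  \<comment> \<open>The assumption \<open>Mj\<close> says that the ratio \<open>C / card M\<close>
    is at least level \<open>j\<close>, and the bound is antimonotone.\<close>
  also have "\<dots> \<le> real (card M) * ?e\<^sup>2"
    using m Mj survival_bound_pos
    by (intro mult_left_mono power_mono survival_bound_antimono)
      (auto simp: field_simps less_imp_le)
  finally have sum: "(\<Sum>i\<in>M. q i ^ ?x i) \<le> real (card M) * ?e\<^sup>2" .
  have "measure_pmf.prob (survivors q M ?x) {M'. real C < real (card M') * ?R (Suc j)} =
      measure_pmf.prob (survivors q M ?x) {M'. real C / ?R (Suc j) < real (card M')}"
    using R[of "Suc j"] by (simp only: pos_divide_less_eq)
  also have "\<dots> \<le> (\<Sum>i\<in>M. q i ^ ?x i) / (real C / ?R (Suc j))"
    using qM u C R[of "Suc j"]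
    by (intro survivors_markov fin divide_pos_pos) (auto simp del: upper_level.simps intro: order_trans[OF _ less_imp_le])
  also have "\<dots> \<le> real (card M) * ?e\<^sup>2 / (real C / ?R (Suc j))"
    using R[of "Suc j"] by (intro divide_right_mono sum divide_nonneg_nonneg) (simp_all only: of_nat_0_le_iff less_imp_le)
  \<comment> \<open>The next level has \<open>?e\<close> in its denominator, which cancels one of
    the two factors \<open>?e\<close>.\<close>
  also have "\<dots> = ?e * (real (card M) * ?R j / real C)"
    using e C by (simp add: power2_eq_square)
  also have "\<dots> \<le> ?e * 1"
    using e Mj C by (intro mult_left_mono) auto
  finally show "measure_pmf.prob (survivors q M ?x) {M'. real C < real (card M') * ?R (Suc j)} \<le> ?e"
    by simp
qed

text \<open>Each term is \<open>1 + e / (1 - e)\<close>. Since \<open>e\<close> is at most a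
  constant over the level, the geometric growth of the levels makes the excess summable, uniformly
  in \<open>r \<ge> a\<close>.\<close>

lemma sum_inverse_survival_le:
  obtains K where "K \<ge> 0" "\<And>r J. a \<le> r \<Longrightarrow>
    (\<Sum>j<J. 1 / (1 - survival_bound u a (upper_level u a r j))) \<le> real J + K"
proof
  define s \<rho> where "s = sqrt u" and "\<rho> = sqrt (1 - (1 - u) * a)"
  have s: "0 < s" "s < 1" using u by (auto simp: s_def)
  have rho: "0 < \<rho>" "\<rho> < 1" using contraction_bounds by (auto simp: \<rho>_def)
  \<comment> \<open>Comes from \<open>s powr (r - 1) = 1 / (s * exp (r * (- ln s)))\<close> and
    \<open>y \<le> exp y\<close>.\<close>
  define B where "B = 1 / (s * (- ln s))"
  have B: "0 < B" using s by (simp add: B_def mult_pos_neg)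
  have eB: "survival_bound u a r \<le> B / r" if "r > 0" for r
  proof -
    have "survival_bound u a r \<le> s powr (r - 1)" by (simp add: survival_bound_def s_def)
    also have "\<dots> = 1 / (s * exp (r * (- ln s)))"
      using s by (simp add: powr_def exp_minus exp_diff left_diff_distrib field_simps)
    also have "\<dots> \<le> 1 / (s * (r * (- ln s)))"
    proof -
      have "r * (- ln s) \<le> exp (r * (- ln s))"
        using exp_ge_add_one_self[of "r * (- ln s)"] by linarith
      then show ?thesis using s that by (intro divide_left_mono mult_left_mono mult_pos_pos) auto
    qed
    finally show ?thesis by (simp add: B_def field_simps)
  qed
  define K where "K = B / (a * (1 - \<rho>)) * (1 / (1 - \<rho>))"
  show "K \<ge> 0" using B a rho by (simp add: K_def)
  fix r J assume r: "a \<le> r"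
  let ?e = "\<lambda>j. survival_bound u a (upper_level u a r j)"
  have "1 / (1 - ?e j) \<le> 1 + B / (a * (1 - \<rho>)) * \<rho> ^ j" for j
  proof -
    have R: "0 < upper_level u a r j" using r a by (intro upper_level_pos) simp
    have e: "0 < ?e j" "?e j \<le> \<rho>"
      using survival_bound_pos survival_bound_le by (auto simp: \<rho>_def)
    have "?e j \<le> B / upper_level u a r j" by (rule eB[OF R])
    also have "\<dots> \<le> B * \<rho> ^ j / a"
    proof -
      have "a \<le> upper_level u a r j * \<rho> ^ j"
        using upper_level_ge[of r j] r a by (simp add: \<rho>_def)
      from mult_left_mono[OF this, of B] B R a show ?thesis by (simp add: field_simps)
    qed
    finally have "?e j \<le> B * \<rho> ^ j / a" .
    moreover have "1 / (1 - ?e j) = 1 + ?e j / (1 - ?e j)"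
      using e rho by (simp add: field_simps)
    moreover have "?e j / (1 - ?e j) \<le> ?e j / (1 - \<rho>)"
      using e rho by (intro divide_left_mono mult_pos_pos) auto
    moreover have "?e j / (1 - \<rho>) \<le> (B * \<rho> ^ j / a) / (1 - \<rho>)"
      using calculation(1) rho by (intro divide_right_mono) auto
    ultimately show ?thesis by (simp add: field_simps)
  qed
  then have "(\<Sum>j<J. 1 / (1 - ?e j)) \<le> (\<Sum>j<J. 1 + B / (a * (1 - \<rho>)) * \<rho> ^ j)"
    by (intro sum_mono)
  also have "\<dots> = real J + B / (a * (1 - \<rho>)) * (\<Sum>j<J. \<rho> ^ j)"
    by (simp add: sum.distrib sum_distrib_left)
  also have "\<dots> \<le> real J + K"
  proof -
    have "(\<Sum>j<J. \<rho> ^ j) \<le> 1 / (1 - \<rho>)"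
      using rho by (simp add: sum_gp_strict divide_right_mono)
    then show ?thesis unfolding K_def using B a rho by (intro add_left_mono mult_left_mono) auto
  qed
  finally show "(\<Sum>j<J. 1 / (1 - ?e j)) \<le> real J + K" .
qed

end

section \<open>Lower levels and the expected time of arbitrary policies\<close>

lemma lower_level_pos: "0 < l \<Longrightarrow> 0 < r \<Longrightarrow> 0 < lower_level l r k"
  by (induction k) auto

lemma lower_level_Suc_ge:
  assumes "0 < l" "l < 1" "0 < r"
  shows "4 * lower_level l r k \<le> lower_level l r (Suc k)"
proof -
  have S: "0 < lower_level l r k" using assms by (intro lower_level_pos)
  have "l powr 0 \<le> l powr (- lower_level l r k)"
    using assms S by (intro powr_mono') auto
  then show ?thesis using S assms by simp
qed

lemma sum_geometric_growth_le:
  fixes S :: "nat \<Rightarrow> real"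
  assumes "\<And>k. 0 \<le> S k" "\<And>k. 4 * S k \<le> S (Suc k)"
  shows "(\<Sum>j\<le>t. S j) \<le> 4 / 3 * S t"
proof (induction t)
  case 0
  show ?case using assms(1)[of 0] by simp
next
  case (Suc t)
  then show ?case using assms(2)[of t] by simp
qed

text \<open>Leaving level \<open>t + 1\<close> behind too early has probability at most
  \<open>S (t + 1) / C\<close>. These terms grow geometrically, so even their double sum over rounds
  is bounded by a constant.\<close>

lemma policies_expected_time_ge:
  assumes l: "0 < l" "l < 1" and n: "n \<ge> 1" and C: "C \<ge> 1"
    and q: "\<And>i. i \<in> {1..n} \<Longrightarrow> l \<le> q i \<and> q i < 1"
    and p: "p \<in> policies n C" and N: "lower_level l (real C / real n) N \<le> real C"
  shows "ennreal (real N - 1) \<le> expected_time n q p"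
proof -
  let ?S = "lower_level l (real C / real n)"
  have S: "0 < ?S k" for k using l n C by (intro lower_level_pos) auto
  have grow: "4 * ?S k \<le> ?S (Suc k)" for k using l n C by (intro lower_level_Suc_ge) auto
  \<comment> \<open>Of the \<open>N + 1\<close> rounds counted here, the accumulated failure
    probabilities remove at most \<open>2\<close>.\<close>
  have "ennreal (\<Sum>t<Suc N. 1 - (\<Sum>j=1..t. ?S j / real C)) \<le> expected_time n q p"
  proof (rule expected_time_ge_levels[OF n, where c = "real C" and S = ?S])
    show "0 \<le> q i \<and> q i < 1" if "i \<in> {1..n}" for i using q[OF that] l by simp
    show "0 < real C" "real C \<le> real n * ?S 0" using C n by auto
    show "0 \<le> ?S t / real C" for t using S[of t] by simp
    fix t M assume M: "M \<subseteq> {1..n}" and Mt: "real C \<le> real (card M) * ?S t"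
    let ?x = "p (Suc t) M"
    have fin: "finite M" using M finite_subset by blast
    have ne: "M \<noteq> {}" using Mt C by auto
    have m: "real (card M) > 0" using fin ne by (simp add: card_gt_0_iff)
    have qM: "l \<le> q i \<and> q i < 1" if "i \<in> M" for i using q M that by blast
    have x: "(\<Sum>i\<in>M. ?x i) = C" using p M ne by (simp add: policies_def)
    \<comment> \<open>The \<open>4\<close> in the recursion of the levels cancels the one in the
      Chernoff hypothesis.\<close>
    have "4 * (real C / ?S (Suc t)) = real C / ?S t * l powr ?S t"
      by (simp add: powr_minus field_simps)
    also have "\<dots> \<le> real (card M) * l powr (real C / real (card M))"
      using Mt S[of t] m l C by (intro mult_mono powr_mono') (auto simp: field_simps)
    also have "\<dots> \<le> (\<Sum>i\<in>M. q i ^ ?x i)"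
      using qM by (intro sum_power_ge_powr_average fin ne l x) auto
    finally have "measure_pmf.prob (survivors q M ?x) {M'. real (card M') < real C / ?S (Suc t)} \<le> 1 / (real C / ?S (Suc t))"
      using qM l C S[of "Suc t"] by (intro survivors_chernoff fin) (auto intro: less_imp_le order_trans)
    moreover have "{M'::nat set. real (card M') * ?S (Suc t) < real C} = {M'. real (card M') < real C / ?S (Suc t)}"
      using S[of "Suc t"] by (simp only: pos_less_divide_eq)
    ultimately show "measure_pmf.prob (survivors q M ?x) {M'. real (card M') * ?S (Suc t) < real C} \<le> ?S (Suc t) / real C"
      by simp
  qed
  moreover have "real N - 1 \<le> (\<Sum>t<Suc N. 1 - (\<Sum>j=1..t. ?S j / real C))"
  proof -
    have "(\<Sum>j=1..t. ?S j) \<le> 4 / 3 * ?S t" for t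
    proof -
      have "(\<Sum>j=1..t. ?S j) \<le> (\<Sum>j\<le>t. ?S j)"
        using S by (intro sum_mono2) (auto intro: less_imp_le)
      also have "\<dots> \<le> 4 / 3 * ?S t"
        using S grow by (intro sum_geometric_growth_le) (auto intro: less_imp_le)
      finally show ?thesis .
    qed
    then have "(\<Sum>t<Suc N. \<Sum>j=1..t. ?S j) \<le> (\<Sum>t<Suc N. 4 / 3 * ?S t)"
      by (intro sum_mono)
    also have "\<dots> = 4 / 3 * (\<Sum>t\<le>N. ?S t)"
      by (simp only: sum_distrib_left lessThan_Suc_atMost)
    also have "\<dots> \<le> 4 / 3 * (4 / 3 * ?S N)"
      using S grow by (intro mult_left_mono sum_geometric_growth_le) (auto intro: less_imp_le)
    \<comment> \<open>The two geometric summations give the factor \<open>16 / 9\<close>.\<close>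
    also have "\<dots> \<le> 2 * real C" using N S[of N] by simp
    finally have "(\<Sum>t<Suc N. \<Sum>j=1..t. ?S j) / real C \<le> 2" using C by (simp add: field_simps)
    moreover have "(\<Sum>t<Suc N. 1 - (\<Sum>j=1..t. ?S j / real C)) =
        real (Suc N) - (\<Sum>t<Suc N. \<Sum>j=1..t. ?S j) / real C"
      by (simp only: sum_subtractf sum_divide_distrib[symmetric]) simp
    ultimately show ?thesis by simp
  qed
  ultimately show ?thesis using ennreal_leI order_trans by blast
qed

text \<open>One application of the recursion multiplies the ratio of the two levels by at least
  \<open>sqrt u powr (1 - \<kappa> S) / (4 * l powr (- S))\<close>, which is at least \<open>1\<close> when \<open>\<kappa>\<close> is large.\<close>

lemma upper_level_dominates_lower_level:
  assumes u: "0 < u" "u < 1" and a: "0 < a" "a \<le> 1" and l: "0 < l" "l < 1"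
  obtains D where "\<And>r k. a \<le> r \<Longrightarrow> lower_level l r k \<le> upper_level u a r (D + k)"
proof -
  define \<rho> where "\<rho> = sqrt (1 - (1 - u) * a)"
  have rho: "0 < \<rho>" "\<rho> < 1" using contraction_bounds[OF u a] by (auto simp: \<rho>_def)
  define \<sigma> \<tau> where "\<sigma> = - ln (sqrt u)" and "\<tau> = - ln l"
  have sig: "0 < \<sigma>" "0 < \<tau>" using u l by (auto simp: \<sigma>_def \<tau>_def)
  \<comment> \<open>Chosen so that
    \<open>ln 4 + S * \<tau> \<le> (\<kappa> * S - 1) * \<sigma>\<close> for every
    \<open>S \<ge> a\<close>.\<close>
  define \<kappa> where "\<kappa> = 1 + (\<tau> + (ln 4 + \<sigma>) / a) / \<sigma>"
  have "0 \<le> (\<tau> + (ln 4 + \<sigma>) / a) / \<sigma>" using sig a by (intro divide_nonneg_nonneg add_nonneg_nonneg) auto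
  then have lam: "1 \<le> \<kappa>" by (simp add: \<kappa>_def)
  obtain D where "\<rho> ^ D < 1 / \<kappa>"
    using real_arch_pow_inv[of "1 / \<kappa>" \<rho>] rho lam by auto
  then have D: "\<kappa> * \<rho> ^ D \<le> 1" using lam by (simp add: field_simps)
  \<comment> \<open>The factor \<open>\<kappa>\<close> strengthens the claim enough for the
    induction to close; the \<open>D\<close> initial steps let the upper levels gain it.\<close>
  have dom: "\<kappa> * lower_level l r k \<le> upper_level u a r (D + k)" if r: "a \<le> r" for r k
  proof (induction k)
    case 0
    have R: "0 < upper_level u a r D" using r a by (intro upper_level_pos u a) simp
    have "\<kappa> * r \<le> \<kappa> * (upper_level u a r D * \<rho> ^ D)"
      unfolding \<rho>_def using lam r a by (intro mult_left_mono upper_level_ge u a) auto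
    also have "\<dots> = upper_level u a r D * (\<kappa> * \<rho> ^ D)" by simp
    also have "\<dots> \<le> upper_level u a r D * 1" using R D by (intro mult_left_mono) auto
    finally show ?case by simp
  next
    case (Suc k)
    let ?S = "lower_level l r k" and ?R = "upper_level u a r (D + k)"
    have S: "a \<le> ?S"
    proof (induction k)
      case (Suc k)
      then show ?case using lower_level_Suc_ge[OF l, of r k] r a by linarith
    qed (simp add: r)
    have R: "0 < ?R" using r a by (intro upper_level_pos u a) simp
    have "ln 4 + ?S * \<tau> \<le> (\<kappa> * ?S - 1) * \<sigma>"
    proof -
      have "(\<kappa> * ?S - 1) * \<sigma> = ?S * \<sigma> + ?S * \<tau> + ?S / a * (ln 4 + \<sigma>) - \<sigma>"
        using sig a by (simp add: \<kappa>_def field_simps)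
      moreover have "ln 4 + \<sigma> \<le> ?S / a * (ln 4 + \<sigma>)"
        using mult_right_mono[of 1 "?S / a" "ln 4 + \<sigma>"] S a sig by simp
      moreover have "0 \<le> ?S * \<sigma>" using S a sig by simp
      ultimately show ?thesis by linarith
    qed
    then have "exp (ln 4 + ?S * \<tau>) \<le> exp ((\<kappa> * ?S - 1) * \<sigma>)" by simp
    moreover have "exp (ln 4 + ?S * \<tau>) = 4 * l powr (- ?S)"
      unfolding exp_add using l by (simp add: powr_def \<tau>_def)
    moreover have "exp ((\<kappa> * ?S - 1) * \<sigma>) = sqrt u powr (1 - \<kappa> * ?S)"
      using u by (simp add: powr_def \<sigma>_def algebra_simps)
    ultimately have key: "4 * l powr (- ?S) \<le> sqrt u powr (1 - \<kappa> * ?S)" by (simp only:)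
    have "\<kappa> * lower_level l r (Suc k) = \<kappa> * ?S * (4 * l powr (- ?S))" by simp
    also have "\<dots> \<le> ?R * sqrt u powr (1 - ?R)"
    proof (intro mult_mono Suc.IH order_trans[OF key] powr_mono')
      show "1 - ?R \<le> 1 - \<kappa> * ?S" using Suc.IH by simp
    qed (use u l R in auto)
    also have "\<dots> = ?R / sqrt u powr (?R - 1)"
      by (simp add: powr_diff field_simps)
    also have "\<dots> \<le> ?R / survival_bound u a ?R"
      using R survival_bound_pos[OF u a] u
      by (intro divide_left_mono mult_pos_pos) (auto simp: survival_bound_def)
    finally show ?case by simp
  qed
  have "lower_level l r k \<le> \<kappa> * lower_level l r k" if "a \<le> r" for r k
    using lower_level_pos[of l r k] l a that lam by (simp add: mult_le_cancel_right1)
  from order_trans[OF this dom] show thesis by (rule that)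
qed

section \<open>Comparison of the two bounds and averaging over the draws\<close>

text \<open>Here \<open>N\<close> is the index just before the lower levels first exceed
  \<open>C\<close>. Domination puts upper level \<open>D + N + 1\<close> above \<open>C\<close> as
  well, so both bounds are \<open>N\<close> up to a constant that depends only on \<open>l\<close>,
  \<open>u\<close> and \<open>a\<close>.\<close>

lemma fair_policy_gap:
  assumes l: "0 < l" "l < 1" and u: "0 < u" "u < 1" and a: "0 < a" "a \<le> 1"
  obtains K where "\<And>n C q. n \<ge> 1 \<Longrightarrow> C \<ge> 1 \<Longrightarrow> (\<And>i. i \<in> {1..n} \<Longrightarrow> l \<le> q i \<and> q i \<le> u) \<Longrightarrow>
    a * real n \<le> real C \<Longrightarrow> \<exists>N.
      (\<forall>p. fair_policy n C p \<longrightarrow> expected_time n q p \<le> ennreal (real N + K)) \<and>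
      (\<forall>p\<in>policies n C. ennreal (real N - 1) \<le> expected_time n q p)" "K \<ge> 0"
proof -
  obtain D where D: "\<And>r k. a \<le> r \<Longrightarrow> lower_level l r k \<le> upper_level u a r (D + k)"
    using upper_level_dominates_lower_level[OF u a l] by blast
  obtain K where K: "K \<ge> 0" "\<And>r J. a \<le> r \<Longrightarrow>
    (\<Sum>j<J. 1 / (1 - survival_bound u a (upper_level u a r j))) \<le> real J + K"
    using sum_inverse_survival_le[OF u a] by blast
  show thesis
  proof
    show "0 \<le> real (Suc D) + K" using K(1) by simp
    fix n C :: nat and q :: "nat \<Rightarrow> real"
    assume n: "n \<ge> 1" and C: "C \<ge> 1" and q: "\<And>i. i \<in> {1..n} \<Longrightarrow> l \<le> q i \<and> q i \<le> u"
      and aC: "a * real n \<le> real C"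
    let ?r = "real C / real n"
    let ?S = "lower_level l ?r"
    have r: "a \<le> ?r" using aC n by (simp add: field_simps)
    have "?S k \<ge> 4 ^ k * ?r" for k
    proof (induction k)
      case (Suc k)
      then show ?case using lower_level_Suc_ge[OF l, of ?r k] r a by simp
    qed simp
    moreover obtain k where "real C / ?r < 4 ^ k" using real_arch_pow[of 4 "real C / ?r"] by auto
    moreover have "0 < ?r" using r a by linarith
    ultimately have "real C < ?S k"
      by (meson less_le_trans pos_divide_less_eq)
    then have ex: "\<exists>k. real C < ?S k" by blast
    define m where "m = (LEAST k. real C < ?S k)"
    have m: "real C < ?S m" unfolding m_def using ex by (rule LeastI_ex)
    have "?S 0 \<le> real C" using n C by (simp add: field_simps)
    then have "m \<noteq> 0" using m by (intro notI) simp
    then obtain N where N: "m = Suc N" using not0_implies_Suc by blast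
    have SN: "?S N \<le> real C"
      using not_less_Least[of N "\<lambda>k. real C < ?S k"] N unfolding m_def by simp
    have J: "real C < upper_level u a ?r (D + Suc N)" using D[OF r, of "Suc N"] m N by simp
    have "expected_time n q p \<le> ennreal (real N + (real (Suc D) + K))" if p: "fair_policy n C p" for p
    proof -
      have "expected_time n q p \<le>
        ennreal (\<Sum>j<D + Suc N. 1 / (1 - survival_bound u a (upper_level u a ?r j)))"
        using q l by (intro fair_policy_expected_time_le[OF u a n C _ aC p J]) force
      also have "\<dots> \<le> ennreal (real N + (real (Suc D) + K))"
        using K(2)[OF r, of "D + Suc N"] by (intro ennreal_leI) simp
      finally show ?thesis .
    qed
    moreover have "ennreal (real N - 1) \<le> expected_time n q p" if "p \<in> policies n C" for p
      using q u by (intro policies_expected_time_ge[OF l n C _ that SN]) force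
    ultimately show "\<exists>N. (\<forall>p. fair_policy n C p \<longrightarrow> expected_time n q p \<le> ennreal (real N + (real (Suc D) + K))) \<and>
      (\<forall>p\<in>policies n C. ennreal (real N - 1) \<le> expected_time n q p)"
      by blast
  qed
qed

text \<open>Almost every draw is a deterministic fair policy, hence admissible for the optimum; both
  inequalities survive averaging.\<close>

lemma fair_randomized_bounds:
  assumes "\<And>p. fair_policy n C p \<Longrightarrow> expected_time n q p \<le> B"
  shows "expected_time_randomized n q (fair_allocation_policy C) \<le> B"
    and "optimal_expected_time n C q \<le> expected_time_randomized n q (fair_allocation_policy C)"
proof -
  let ?P = "policy_draws n (fair_allocation_policy C)"
  interpret P: prob_space ?P by (rule prob_space_policy_draws)
  have AE: "AE p in ?P. fair_policy n C p"
    using AE_policy_draws[of n "fair_allocation_policy C"] by (simp add: fair_policy_def)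
  have const: "(\<integral>\<^sup>+ p. c \<partial>?P) = c" for c by (simp add: P.emeasure_space_1)
  have "(\<integral>\<^sup>+ p. expected_time n q p \<partial>?P) \<le> (\<integral>\<^sup>+ p. B \<partial>?P)"
    using AE by (intro nn_integral_mono_AE) (auto elim!: eventually_mono intro: assms)
  then show "expected_time_randomized n q (fair_allocation_policy C) \<le> B"
    unfolding expected_time_randomized_eq const .
  have "(\<integral>\<^sup>+ p. optimal_expected_time n C q \<partial>?P) \<le> (\<integral>\<^sup>+ p. expected_time n q p \<partial>?P)"
    using AE by (intro nn_integral_mono_AE)
      (auto elim!: eventually_mono simp: optimal_expected_time_def intro!: INF_lower fair_policy_in_policies)
  then show "optimal_expected_time n C q \<le> expected_time_randomized n q (fair_allocation_policy C)"
    unfolding expected_time_randomized_eq const .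
qed

theorem theorem5:
  fixes ql qu \<alpha> :: real
  assumes "0 < ql" and "ql < qu" and "qu < 1" and "\<alpha> > 0"
  shows "\<exists>K::real. \<forall>(C :: nat \<Rightarrow> nat) (q :: nat \<Rightarrow> nat \<Rightarrow> real).
    (\<forall>n\<ge>1. threat_instance n (C n) (q n)) \<longrightarrow>
    (\<forall>n\<ge>1. \<forall>i\<in>{1..n}. q n i \<in> {ql..qu}) \<longrightarrow>
    (\<forall>\<^sub>F n in sequentially. real (C n) \<ge> \<alpha> * real n) \<longrightarrow>
    (\<forall>\<^sub>F n in sequentially.
       (let fa = expected_time_randomized n (q n) (fair_allocation_policy (C n));
            opt = optimal_expected_time n (C n) (q n)
        in fa < \<infinity> \<and> opt < \<infinity> \<and>
           0 \<le> enn2real fa - enn2real opt \<and> enn2real fa - enn2real opt \<le> K))"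
proof -
  \<comment> \<open>Truncation at \<open>1\<close> meets the requirement \<open>a \<le> 1\<close> of
    the level estimates and preserves the capacity bound.\<close>
  define a where "a = min \<alpha> 1"
  have a: "0 < a" "a \<le> 1" "a \<le> \<alpha>" using assms(4) by (auto simp: a_def)
  obtain K where K: "\<And>n C q. n \<ge> 1 \<Longrightarrow> C \<ge> 1 \<Longrightarrow> (\<And>i. i \<in> {1..n} \<Longrightarrow> ql \<le> q i \<and> q i \<le> qu) \<Longrightarrow>
    a * real n \<le> real C \<Longrightarrow> \<exists>N.
      (\<forall>p. fair_policy n C p \<longrightarrow> expected_time n q p \<le> ennreal (real N + K)) \<and>
      (\<forall>p\<in>policies n C. ennreal (real N - 1) \<le> expected_time n q p)" "K \<ge> 0"
    using fair_policy_gap[of ql qu a] assms a by auto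
  have main: "let fa = expected_time_randomized n q (fair_allocation_policy C);
            opt = optimal_expected_time n C q
        in fa < \<infinity> \<and> opt < \<infinity> \<and>
           0 \<le> enn2real fa - enn2real opt \<and> enn2real fa - enn2real opt \<le> K + 1"
    if n: "n \<ge> 1" and inst: "threat_instance n C q" and q: "\<forall>i\<in>{1..n}. q i \<in> {ql..qu}"
      and C: "\<alpha> * real n \<le> real C" for n C q
  proof -
    define fa opt where "fa = expected_time_randomized n q (fair_allocation_policy C)"
      and "opt = optimal_expected_time n C q"
    have C1: "C \<ge> 1" using inst by (simp add: threat_instance_def)
    have "a * real n \<le> \<alpha> * real n" using a by (intro mult_right_mono) auto
    then have aC: "a * real n \<le> real C" using C by linarith
    obtain N where N: "\<And>p. fair_policy n C p \<Longrightarrow> expected_time n q p \<le> ennreal (real N + K)"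
      "\<And>p. p \<in> policies n C \<Longrightarrow> ennreal (real N - 1) \<le> expected_time n q p"
      using K(1)[OF n C1 _ aC, of q] q by auto
    have fa: "fa \<le> ennreal (real N + K)" "opt \<le> fa"
      unfolding fa_def opt_def using fair_randomized_bounds[OF N(1)] by auto
    have opt: "ennreal (real N - 1) \<le> opt"
      unfolding opt_def optimal_expected_time_def by (intro INF_greatest N(2))
    have fin: "fa < \<infinity>" "opt < \<infinity>"
      using fa le_less_trans[OF fa(1)] le_less_trans[OF order_trans[OF fa(2,1)]] by auto
    have "enn2real fa \<le> real N + K" using fa(1) K(2) by (intro enn2real_leI) auto
    \<comment> \<open>For \<open>N = 0\<close> the left side is negative and \<open>ennreal\<close>
      truncates it, so this case is separate.\<close>
    moreover have "real N - 1 \<le> enn2real opt"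
      using enn2real_mono[OF opt] fin(2) by (cases "real N - 1 \<ge> 0") (auto intro: order_trans[OF _ enn2real_nonneg])
    moreover have "enn2real opt \<le> enn2real fa" using fa(2) fin(1) by (intro enn2real_mono) auto
    ultimately show ?thesis using fin unfolding fa_def opt_def Let_def by linarith
  qed
  show ?thesis
  proof (intro exI[of _ "K + 1"] allI impI)
    fix C :: "nat \<Rightarrow> nat" and q :: "nat \<Rightarrow> nat \<Rightarrow> real"
    assume inst: "\<forall>n\<ge>1. threat_instance n (C n) (q n)"
      and q: "\<forall>n\<ge>1. \<forall>i\<in>{1..n}. q n i \<in> {ql..qu}"
      and C: "\<forall>\<^sub>F n in sequentially. real (C n) \<ge> \<alpha> * real n"
    show "\<forall>\<^sub>F n in sequentially.
       (let fa = expected_time_randomized n (q n) (fair_allocation_policy (C n));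
            opt = optimal_expected_time n (C n) (q n)
        in fa < \<infinity> \<and> opt < \<infinity> \<and>
           0 \<le> enn2real fa - enn2real opt \<and> enn2real fa - enn2real opt \<le> K + 1)"
      using C eventually_ge_at_top[of 1]
    proof eventually_elim
      case (elim n)
      then show ?case using main[of n "C n" "q n"] inst q by blast
    qed
  qed
qed

end
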